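(* Let $N=2$. Then the success probability of dual-branch MRC is $$\mathtt{P}_{\mathrm{MRC}}=\sum_{k=0}^{m_{\mathrm D}-1}\frac{(-1)^{k+m_{\mathrm D}}}{k!\,\Gamma(m_{\mathrm D})}\int_0^\infty \frac{1}{z}\,\frac{\partial^{k}\partial^{m_{\mathrm D}}}{\partial s^{k}\partial t^{m_{\mathrm D}}}\left[\exp\!\left(-\frac{(T-z)^{+}s\,m_{\mathrm D}}{\mathtt{SNR}}-\frac{z t\, m_{\mathrm D}}{\mathtt{SNR}}-\pi\lambda\,\mathcal A(z,s,t)\right)\right]_{s=1,\,t=1}\mathrm dz,$$ where, for $s,t>0$, $$\mathcal A(z,s,t)=\begin{cases} s^{2/\alpha}(T-z)^{2/\alpha}d^{2}\,\Gamma(1-\tfrac{2}{\alpha})\left(\tfrac{m_{\mathrm D}}{m_{\mathrm I}}\right)^{2/\alpha}\Gamma(\tfrac{2}{\alpha}+2m_{\mathrm I})\;{}_2\mathbf F_1\!\left(-\tfrac{2}{\alpha},m_{\mathrm I};2m_{\mathrm I};1-\tfrac{zt}{(T-z)s}\right), & 0\le z<T,\\[4pt] (zt)^{2/\alpha}d^{2}\,\Gamma(1-\tfrac{2}{\alpha})\left(\tfrac{m_{\mathrm D}}{m_{\mathrm I}}\right)^{2/\alpha}\dfrac{\Gamma(\tfrac{2}{\alpha}+m_{\mathrm I})}{\Gamma(m_{\mathrm I})}, & z\ge T.\end{cases}$$ (When $\mathtt{SNR}=\infty$ the terms with $\mathtt{SNR}^{-1}$ are absent.)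
   Context: Let $\Phi=\{\mathsf x_i\}_{i\ge0}$ be a homogeneous Poisson point process on $\mathbb R^2$ of intensity $\lambda>0$ (interferer locations). A receiver with $N$ antennas is at the origin; the desired transmitter is at distance $d>0$. Fix a path loss exponent $\alpha>2$, an average signal-to-noise ratio $\mathtt{SNR}\in(0,\infty]$, and a threshold $T>0$. Fading gains: $\mathsf g_1,\dots,\mathsf g_N$ are Gamma distributed with shape $m_{\mathrm D}$ and scale $1/m_{\mathrm D}$ (density $\frac{m^m y^{m-1}}{\Gamma(m)}e^{-my}$, $y\ge0$, with $m=m_{\mathrm D}$), where $m_{\mathrm D}$ is a positive integer; for each branch $n$ and each interferer $i$, $\mathsf h_{n,i}$ is Gamma distributed with shape $m_{\mathrm I}>0$ and scale $1/m_{\mathrm I}$; all $\mathsf g_n$ and $\mathsf h_{n,i}$ are mutually independent and independent of $\Phi$. The normalized interference at branch $n$ is $\mathsf I_n=d^{\alpha}\sum_{i}\mathsf h_{n,i}\|\mathsf x_i\|^{-\alpha}$. The post-combiner SINR of (interference-aware) MRC is $\mathsf{SINR}_{\mathrm{MRC}}=\sum_{n=1}^N \frac{\mathsf g_n}{\mathsf I_n+\mathtt{SNR}^{-1}}$ and the success probability is $\mathtt P_{\mathrm{MRC}}=\mathbb P(\mathsf{SINR}_{\mathrm{MRC}}\ge T)$. $(x)^+=\max\{0,x\}$. ${}_2\mathbf F_1(a,b;c;x)={}_2F_1(a,b;c;x)/\Gamma(c)$ denotes the regularized Gauss hypergeometric function (analytically continued to $x<1$). *)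

theory Defs
  imports "HOL-Probability.Probability"
begin

definition gamma_density :: "real \<Rightarrow> real \<Rightarrow> real" where
  "gamma_density m y =
     (if 0 \<le> y then m powr m * y powr (m - 1) / Gamma m * exp (- m * y) else 0)"

definition count_in :: "(nat \<Rightarrow> 'a \<Rightarrow> real^2) \<Rightarrow> (real^2) set \<Rightarrow> 'a \<Rightarrow> nat" where
  "count_in X B \<omega> = card {i. X i \<omega> \<in> B}"

definition is_PPP :: "'a measure \<Rightarrow> real \<Rightarrow> (nat \<Rightarrow> 'a \<Rightarrow> real^2) \<Rightarrow> bool" where
  "is_PPP M lam X \<longleftrightarrow>
     (\<forall>i. X i \<in> borel_measurable M) \<and>
     (\<forall>\<omega>\<in>space M. inj (\<lambda>i. X i \<omega>)) \<and>
     (\<forall>B. B \<in> sets lborel \<and> bounded B \<longrightarrow>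
        (AE \<omega> in M. finite {i. X i \<omega> \<in> B}) \<and>
        (\<forall>k::nat. measure M {\<omega>\<in>space M. count_in X B \<omega> = k} =
            (lam * measure lborel B) ^ k / fact k * exp (- (lam * measure lborel B)))) \<and>
     (\<forall>(Bs :: nat \<Rightarrow> (real^2) set) n.
        (\<forall>j<n. Bs j \<in> sets lborel \<and> bounded (Bs j)) \<and> disjoint_family_on Bs {..<n} \<longrightarrow>
        prob_space.indep_vars M (\<lambda>_. count_space UNIV) (\<lambda>j. count_in X (Bs j)) {..<n})"

definition hyp2F1_series :: "complex \<Rightarrow> complex \<Rightarrow> complex \<Rightarrow> complex \<Rightarrow> complex" where
  "hyp2F1_series a b c z =
     (\<Sum>n. pochhammer a n * pochhammer b n / (pochhammer c n * fact n) * z ^ n)"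

definition slit_plane :: "complex set" where
  "slit_plane = {z. \<not> (Im z = 0 \<and> 1 \<le> Re z)}"

text \<open>Principal branch: the unique holomorphic function on the slit plane that agrees with the
  Gauss series on the unit disc (normalised to 0 off the slit plane), evaluated at real x < 1.\<close>
definition hyp2F1 :: "real \<Rightarrow> real \<Rightarrow> real \<Rightarrow> real \<Rightarrow> real" where
  "hyp2F1 a b c x =
     Re ((THE f. f holomorphic_on slit_plane \<and>
             (\<forall>z. cmod z < 1 \<longrightarrow> f z = hyp2F1_series (of_real a) (of_real b) (of_real c) z) \<and>
             (\<forall>z. z \<notin> slit_plane \<longrightarrow> f z = 0)) (of_real x))"

text \<open>Regularized version (used here only with c > 0).\<close>
definition hyp2F1_reg :: "real \<Rightarrow> real \<Rightarrow> real \<Rightarrow> real \<Rightarrow> real" where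
  "hyp2F1_reg a b c x = hyp2F1 a b c x / Gamma c"

definition snr_inv :: "ereal \<Rightarrow> real" where
  "snr_inv snr = (if snr = \<infinity> then 0 else 1 / real_of_ereal snr)"

definition A_fun :: "real \<Rightarrow> real \<Rightarrow> real \<Rightarrow> nat \<Rightarrow> real \<Rightarrow> real \<Rightarrow> real \<Rightarrow> real \<Rightarrow> real" where
  "A_fun \<alpha> d T mD mI z s t =
     (if z < T then
        s powr (2/\<alpha>) * (T - z) powr (2/\<alpha>) * d^2 * Gamma (1 - 2/\<alpha>) * (real mD / mI) powr (2/\<alpha>)
        * Gamma (2/\<alpha> + 2*mI) * hyp2F1_reg (-2/\<alpha>) mI (2*mI) (1 - z * t / ((T - z) * s))
      else
        (z*t) powr (2/\<alpha>) * d^2 * Gamma (1 - 2/\<alpha>) * (real mD / mI) powr (2/\<alpha>)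
        * Gamma (2/\<alpha> + mI) / Gamma mI)"

definition MRC_kernel ::
  "real \<Rightarrow> real \<Rightarrow> real \<Rightarrow> real \<Rightarrow> nat \<Rightarrow> real \<Rightarrow> ereal \<Rightarrow> real \<Rightarrow> real \<Rightarrow> real \<Rightarrow> real" where
  "MRC_kernel lam \<alpha> d T mD mI snr z s t =
     exp (- (max 0 (T - z)) * s * real mD * snr_inv snr
          - z * t * real mD * snr_inv snr
          - pi * lam * A_fun \<alpha> d T mD mI z s t)"

definition interference ::
  "real \<Rightarrow> real \<Rightarrow> (nat \<Rightarrow> nat \<Rightarrow> 'a \<Rightarrow> real) \<Rightarrow> (nat \<Rightarrow> 'a \<Rightarrow> real^2) \<Rightarrow> nat \<Rightarrow> 'a \<Rightarrow> real" where
  "interference \<alpha> d h X n \<omega> = d powr \<alpha> * (\<Sum>i. h n i \<omega> * norm (X i \<omega>) powr (- \<alpha>))"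

definition SINR_MRC2 ::
  "real \<Rightarrow> real \<Rightarrow> ereal \<Rightarrow> (nat \<Rightarrow> 'a \<Rightarrow> real) \<Rightarrow> (nat \<Rightarrow> nat \<Rightarrow> 'a \<Rightarrow> real)
     \<Rightarrow> (nat \<Rightarrow> 'a \<Rightarrow> real^2) \<Rightarrow> 'a \<Rightarrow> real" where
  "SINR_MRC2 \<alpha> d snr g h X \<omega> =
     (\<Sum>n\<in>{1,2}. g n \<omega> / (interference \<alpha> d h X n \<omega> + snr_inv snr))"

end

theory Submission
  imports Defs "HOL-Complex_Analysis.Complex_Analysis" "HOL-Real_Asymp.Real_Asymp"
begin

text \<open>
  Write \<open>\<delta> = 2/\<alpha>\<close>, \<open>m = m\<^sub>D\<close> and \<open>I\<^sub>n' = I\<^sub>n + 1/SNR\<close>. Given the interference, \<open>z = g\<^sub>2/I\<^sub>2'\<close> has a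
  Gamma density and \<open>g\<^sub>1\<close> has an Erlang tail, so the conditional success probability is
  \<open>\<Sum>\<^sub>k \<integral> A\<^sup>k B\<^sup>m exp (- A - B) / (z k! \<Gamma>(m)) dz\<close> with \<open>A = m (T - z)\<^sup>+ I\<^sub>1'\<close> and \<open>B = m z I\<^sub>2'\<close>. The expectation of
  \<open>A\<^sup>k B\<^sup>m exp (- A - B)\<close> is, up to sign, a mixed derivative of \<open>E exp (- s A - t B)\<close> at \<open>s = t = 1\<close>. All
  integrands are nonnegative, so Tonelli applies and integrability in \<open>z\<close> comes for free.

  For the Laplace transform of the interference, condition on the locations and use the Laplace
  functional of the Poisson process. The layer-cake formula reduces
  \<open>\<integral> (1 - exp (- y |x|\<^sup>-\<^sup>\<alpha>)) dx\<close> to areas of discs and gives \<open>\<pi> \<Gamma>(1 - \<delta>) y\<^sup>\<delta>\<close>, which leaves the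
  moment \<open>E (u h\<^sub>1 + v h\<^sub>2)\<^sup>\<delta>\<close>. Since \<open>h\<^sub>1 + h\<^sub>2\<close> is Gamma distributed and independent of the
  Beta distributed ratio \<open>h\<^sub>2/(h\<^sub>1 + h\<^sub>2)\<close>, this moment is Euler's integral for the hypergeometric function.
\<close>

section \<open>Euler's integral for the hypergeometric function\<close>

text \<open>Three features of the definitions shape the proof. \<open>hyp2F1\<close> is a definite
  description of an analytic continuation, and its argument 1 - zt/((T - z)s) also falls below -1,
  where the Gauss series diverges. So Euler's integral has to be shown holomorphic on the whole slit
  plane and matched with the series on the disc before it may be evaluated at a real point.
  \<open>interference\<close> is a real infinite sum whose convergence is not assumed, and for
  infinite SNR a vanishing interference would put 0 into a denominator. The sums are therefore taken
  in \<open>ennreal\<close>, with exp (- \<infinity>) = 0; that they are almost surely finite and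
  positive is read off their own Laplace transforms exp (- const * u powr \<delta>) as u tends to 0
  and to infinity. Finally, the two interferences are dependent although their fading is
  independent, because both branches see the same points. For frozen locations the two Laplace
  factors multiply point by point, and the product enters the Laplace functional as a single
  function of the location. This is why a moment of the combination u h1 + v h2 appears instead of
  two separate moments.\<close>

lemma has_field_derivative_integral_dominated:
  fixes f :: "'k::{real_normed_field,banach,second_countable_topology} \<Rightarrow> 'a \<Rightarrow> 'k"
  assumes r: "r > 0"
    and int: "\<And>z. z \<in> ball z0 r \<Longrightarrow> integrable M (f z)"
    and deriv: "\<And>z x. z \<in> ball z0 r \<Longrightarrow> x \<in> space M \<Longrightarrow> ((\<lambda>z. f z x) has_field_derivative f' z x) (at z)"
    and bound: "\<And>z x. z \<in> ball z0 r \<Longrightarrow> x \<in> space M \<Longrightarrow> norm (f' z x) \<le> w x"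
    and w: "integrable M w"
    and meas: "f' z0 \<in> borel_measurable M"
  shows "((\<lambda>z. \<integral>x. f z x \<partial>M) has_field_derivative (\<integral>x. f' z0 x \<partial>M)) (at z0)"
  unfolding has_field_derivative_iff tendsto_at_iff_sequentially
proof (intro allI impI, unfold comp_def)
  fix Z :: "nat \<Rightarrow> 'k"
  assume Z: "\<forall>i. Z i \<in> UNIV - {z0}" and Zl: "Z \<longlonglongrightarrow> z0"
  from Zl r have "eventually (\<lambda>n. Z n \<in> ball z0 r) sequentially"
    by (intro topological_tendstoD) auto
  then obtain N where N: "\<And>n. n \<ge> N \<Longrightarrow> Z n \<in> ball z0 r"
    by (auto simp: eventually_sequentially)
  let ?q = "\<lambda>n x. (f (Z (n + N)) x - f z0 x) / (Z (n + N) - z0)"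
  have "(\<lambda>n. \<integral>x. ?q n x \<partial>M) \<longlonglongrightarrow> (\<integral>x. f' z0 x \<partial>M)"
  proof (rule integral_dominated_convergence[where w = w])
    show "f' z0 \<in> borel_measurable M" "integrable M w" by fact+
    show "?q n \<in> borel_measurable M" for n
      using borel_measurable_integrable[OF int[OF N, of "n + N"]] borel_measurable_integrable[OF int[of z0]] r
      by (intro borel_measurable_divide borel_measurable_diff) auto
    show "AE x in M. (\<lambda>n. ?q n x) \<longlonglongrightarrow> f' z0 x"
    proof (intro AE_I2)
      fix x assume x: "x \<in> space M"
      have "((\<lambda>z. f z x) has_field_derivative f' z0 x) (at z0)"
        using deriv[OF _ x, of z0] r by auto
      then have "(\<lambda>n. (f (Z n) x - f z0 x) / (Z n - z0)) \<longlonglongrightarrow> f' z0 x"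
        unfolding has_field_derivative_iff tendsto_at_iff_sequentially comp_def using Z Zl by auto
      then show "(\<lambda>n. ?q n x) \<longlonglongrightarrow> f' z0 x"
        by (rule LIMSEQ_ignore_initial_segment)
    qed
    show "AE x in M. norm (?q n x) \<le> w x" for n
    proof (intro AE_I2)
      fix x assume x: "x \<in> space M"
      \<comment> \<open>Mean value inequality on the convex ball: the bound on the derivative
        becomes a majorant for all difference quotients.\<close>
      have "norm (f (Z (n + N)) x - f z0 x) \<le> w x * norm (Z (n + N) - z0)"
        by (rule field_differentiable_bound[where S = "ball z0 r" and f' = "\<lambda>z. f' z x"])
           (use deriv[OF _ x] bound[OF _ x] N[of "n + N"] r in \<open>auto intro: has_field_derivative_at_within\<close>)
      then show "norm (?q n x) \<le> w x"
        using Z by (auto simp: norm_divide divide_simps)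
    qed
  qed
  moreover have "(\<integral>x. ?q n x \<partial>M) = ((\<integral>x. f (Z (n + N)) x \<partial>M) - (\<integral>x. f z0 x \<partial>M)) / (Z (n + N) - z0)" for n
    using int[OF N, of "n + N"] int[of z0] r by simp
  ultimately have "(\<lambda>n. ((\<integral>x. f (Z (n + N)) x \<partial>M) - (\<integral>x. f z0 x \<partial>M)) / (Z (n + N) - z0)) \<longlonglongrightarrow> (\<integral>x. f' z0 x \<partial>M)"
    by (simp only:)
  then show "(\<lambda>n. ((\<integral>x. f (Z n) x \<partial>M) - (\<integral>x. f z0 x \<partial>M)) / (Z n - z0)) \<longlonglongrightarrow> (\<integral>x. f' z0 x \<partial>M)"
    by (rule LIMSEQ_offset)
qed

section \<open>The slit plane and uniqueness of the analytic continuation\<close>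

lemma open_slit_plane: "open slit_plane"
proof -
  have "slit_plane = - ({z. Im z = 0} \<inter> {z. 1 \<le> Re z})"
    by (auto simp: slit_plane_def)
  moreover have "closed ({z. Im z = 0} \<inter> {z. 1 \<le> Re z})"
    by (intro closed_Int closed_Collect_eq closed_Collect_le continuous_intros)
  ultimately show ?thesis by (metis open_Compl)
qed

text \<open>If 1 - zt were a nonpositive real, then t > 0 and z would be real with z \<ge> 1/t \<ge>
  1, a point of the cut. So the principal power in Euler's integrand is holomorphic in z on exactly
  the slit plane.\<close>

lemma one_minus_mult_notin_nonpos_Reals:
  assumes "z \<in> slit_plane" "t \<in> {0..1}"
  shows "1 - z * of_real t \<notin> \<real>\<^sub>\<le>\<^sub>0"
proof
  assume "1 - z * of_real t \<in> \<real>\<^sub>\<le>\<^sub>0"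
  then have 1: "1 \<le> Re z * t" and 2: "Im z * t = 0" by (auto simp: complex_nonpos_Reals_iff)
  from 1 assms have "t > 0" by (cases "t = 0") auto
  with 2 have "Im z = 0" by simp
  moreover have "Re z \<ge> 1"
  proof (rule ccontr)
    assume "\<not> Re z \<ge> 1"
    then have "Re z * t < 1" using assms \<open>t > 0\<close>
      by (metis atLeastAtMost_iff less_eq_real_def linorder_not_le mult_le_one mult_less_cancel_right2 order_less_le_trans)
    with 1 show False by simp
  qed
  ultimately show False using assms by (auto simp: slit_plane_def)
qed

lemma connected_slit_plane: "connected slit_plane"
proof (rule starlike_imp_connected)
  show "starlike slit_plane"
    unfolding starlike_def
  proof (intro bexI ballI subsetI)
    show "0 \<in> slit_plane" by (auto simp: slit_plane_def)
    fix z w assume z: "z \<in> slit_plane" and "w \<in> closed_segment 0 z"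
    then obtain t where t: "t \<in> {0..1}" "w = of_real t * z"
      by (auto simp: closed_segment_def scaleR_conv_of_real)
    have "1 - z * of_real t \<notin> \<real>\<^sub>\<le>\<^sub>0" by (rule one_minus_mult_notin_nonpos_Reals) fact+
    then show "w \<in> slit_plane"
      by (auto simp: slit_plane_def complex_nonpos_Reals_iff t mult.commute)
  qed
qed

text \<open>\<open>THE\<close> needs a unique total function. On the slit plane uniqueness is the
  identity theorem, starting from the unit disc; off it the prescribed value 0 settles the matter,
  so the candidate is cut off there as well.\<close>

lemma hyp2F1_eqI:
  assumes hol: "F holomorphic_on slit_plane"
    and ser: "\<And>z. cmod z < 1 \<Longrightarrow> F z = hyp2F1_series (of_real a) (of_real b) (of_real c) z"
    and x: "x < 1"
  shows "hyp2F1 a b c x = Re (F (of_real x))"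
proof -
  let ?P = "\<lambda>f. f holomorphic_on slit_plane \<and>
             (\<forall>z. cmod z < 1 \<longrightarrow> f z = hyp2F1_series (of_real a) (of_real b) (of_real c) z) \<and>
             (\<forall>z. z \<notin> slit_plane \<longrightarrow> f z = 0)"
  let ?G = "\<lambda>z. if z \<in> slit_plane then F z else 0"
  have disc: "z \<in> slit_plane" if "cmod z < 1" for z
    using that complex_Re_le_cmod[of z] by (auto simp: slit_plane_def)
  have "?P ?G"
    using hol ser disc by (auto intro: holomorphic_transform)
  moreover have "f = ?G" if f: "?P f" for f
  proof
    fix z show "f z = ?G z"
    proof (cases "z \<in> slit_plane")
      case True
      have "f z = F z"
      proof (rule analytic_continuation_open[of "ball 0 1" slit_plane f F z])
        show "open (ball 0 1 :: complex set)" "ball 0 1 \<noteq> ({} :: complex set)" by auto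
        show "open slit_plane" "connected slit_plane" by (rule open_slit_plane connected_slit_plane)+
        show "ball 0 1 \<subseteq> slit_plane" using disc by auto
      qed (use f hol ser True in auto)
      with True show ?thesis by simp
    qed (use f in auto)
  qed
  ultimately have "(THE f. ?P f) = ?G" by (rule the_equality)
  then have "hyp2F1 a b c x = Re (?G (of_real x))" unfolding hyp2F1_def by simp
  moreover have "complex_of_real x \<in> slit_plane" using x by (simp add: slit_plane_def)
  ultimately show ?thesis by simp
qed

section \<open>Beta weights and Euler's integral\<close>

text \<open>Not normalised: the total mass is \<open>Beta a b\<close>. The space itself is
  restricted to [0, 1], so that bounds and continuity are only ever required on the compact
  interval.\<close>

definition beta_measure :: "real \<Rightarrow> real \<Rightarrow> real measure" where
  "beta_measure a b = density (restrict_space lborel {0..1})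
     (\<lambda>t. ennreal (t powr (a - 1) * (1 - t) powr (b - 1)))"

lemma space_beta_measure [simp]: "space (beta_measure a b) = {0..1}"
  by (simp add: beta_measure_def space_restrict_space)

lemma sets_beta_measure:
  "sets (beta_measure a b) = sets (restrict_space borel {0..1})"
  by (simp add: beta_measure_def cong: sets_restrict_space_cong)

lemma borel_measurable_beta_measure:
  "f \<in> borel_measurable borel \<Longrightarrow> f \<in> borel_measurable (beta_measure a b)"
  unfolding measurable_cong_sets[OF sets_beta_measure refl] by (rule measurable_restrict_space1)

lemma nn_integral_beta_measure:
  assumes [measurable]: "f \<in> borel_measurable borel"
  shows "(\<integral>\<^sup>+t. f t \<partial>beta_measure a b) =
    (\<integral>\<^sup>+t. indicator {0..1} t * ennreal (t powr (a - 1) * (1 - t) powr (b - 1)) * f t \<partial>lborel)"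
proof -
  have "(\<integral>\<^sup>+t. f t \<partial>beta_measure a b) =
      (\<integral>\<^sup>+t. ennreal (t powr (a - 1) * (1 - t) powr (b - 1)) * f t \<partial>restrict_space lborel {0..1})"
    unfolding beta_measure_def by (subst nn_integral_density) (auto intro!: measurable_restrict_space1)
  also have "\<dots> = (\<integral>\<^sup>+t. indicator {0..1} t * ennreal (t powr (a - 1) * (1 - t) powr (b - 1)) * f t \<partial>lborel)"
    by (subst nn_integral_restrict_space) (auto simp: ac_simps)
  finally show ?thesis .
qed

lemma integral_power_beta_measure:
  assumes "a > 0" "b > 0"
  shows "(\<integral>t. t ^ n \<partial>beta_measure a b) = Beta (a + real n) b"
    and "finite_measure (beta_measure a b)"
proof -
  have eq: "(\<integral>\<^sup>+t. ennreal (t ^ n) \<partial>beta_measure a b) = ennreal (Beta (a + real n) b)" for n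
  proof -
    have "(\<integral>\<^sup>+t. ennreal (t ^ n) \<partial>beta_measure a b) =
        (\<integral>\<^sup>+t. ennreal (indicator {0..1} t * (t powr (a + real n - 1) * (1 - t) powr (b - 1))) \<partial>lborel)"
    proof (subst nn_integral_beta_measure, simp, intro nn_integral_cong_AE)
      \<comment> \<open>At the origin \<open>t ^ 0\<close> is 1 but \<open>t powr 0\<close> is 0, so
        the power is merged into the \<open>powr\<close> factor only away from 0.\<close>
      have "AE t in lborel. (t::real) \<noteq> 0" by (rule AE_lborel_singleton)
      then show "AE t in lborel. indicator {0..1} t * ennreal (t powr (a - 1) * (1 - t) powr (b - 1)) * ennreal (t ^ n) =
            ennreal (indicator {0..1} t * (t powr (a + real n - 1) * (1 - t) powr (b - 1)))"
        by eventually_elim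
           (auto split: split_indicator simp: ennreal_mult[symmetric] powr_realpow[symmetric] powr_add[symmetric] algebra_simps)
    qed
    also have "\<dots> = ennreal (Beta (a + real n) b)"
      using nn_integral_has_integral_lebesgue[OF _ has_integral_Beta_real[of "a + real n" b]] assms by simp
    finally show ?thesis .
  qed
  have pos: "Beta (a + real n) b > 0" for n
    using assms by (simp add: Beta_def)
  have meas: "(\<lambda>t. t ^ n) \<in> borel_measurable (beta_measure a b)" for n
    by (rule borel_measurable_beta_measure) simp
  show "(\<integral>t. t ^ n \<partial>beta_measure a b) = Beta (a + real n) b"
    by (rule integral_eq_nn_integral[THEN trans]) (use eq[of n] pos[of n] meas in \<open>auto intro: less_imp_le\<close>)
  show "finite_measure (beta_measure a b)"
    using eq[of 0] by (intro finite_measureI) simp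
qed

text \<open>Around each z some closed ball stays in the slit plane, and the z-derivative of the
  integrand is continuous on the compact product of that ball with [0, 1]. A constant therefore
  dominates it. The endpoint singularities sit in the measure, whose finiteness makes constants
  integrable.\<close>

lemma holomorphic_Euler_integral:
  assumes fin: "finite_measure (beta_measure b c)"
  shows "(\<lambda>z. \<integral>t. (1 - z * of_real t) powr (- of_real a) \<partial>beta_measure b c) holomorphic_on slit_plane"
proof -
  interpret finite_measure "beta_measure b c" by (rule fin)
  let ?K = "beta_measure b c"
  let ?f = "\<lambda>z t. (1 - z * of_real t) powr (- complex_of_real a)"
  let ?f' = "\<lambda>z t. of_real t * of_real a * (1 - z * of_real t) powr (- complex_of_real a - 1)"
  show ?thesis
    unfolding holomorphic_on_open[OF open_slit_plane]
  proof (intro ballI exI)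
    fix z assume "z \<in> slit_plane"
    then obtain r where r: "r > 0" "cball z r \<subseteq> slit_plane"
      using open_slit_plane open_contains_cball by blast
    have notneg: "1 - w * of_real t \<notin> \<real>\<^sub>\<le>\<^sub>0" if "w \<in> cball z r" "t \<in> {0..1}" for w t
      using that r by (intro one_minus_mult_notin_nonpos_Reals) auto
    have powr: "continuous_on (- \<real>\<^sub>\<le>\<^sub>0) (\<lambda>w. w powr q)" for q :: complex
      by (intro holomorphic_on_imp_continuous_on holomorphic_intros) auto
    have cont: "continuous_on {0..1} (?f w)" "continuous_on {0..1} (?f' w)" if "w \<in> cball z r" for w
      using notneg[OF that] by (intro continuous_intros continuous_on_compose2[OF powr]; force)+
    have meas: "g \<in> borel_measurable ?K" if "continuous_on {0..1} g" for g :: "real \<Rightarrow> complex"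
      unfolding measurable_cong_sets[OF sets_beta_measure refl] using that
      by (rule borel_measurable_continuous_on_restrict)
    have bnd: "\<exists>B. \<forall>t\<in>{0..1}. norm (g t) \<le> B" if "continuous_on {0..1} g" for g :: "real \<Rightarrow> complex"
      using compact_imp_bounded[OF compact_continuous_image[OF that]] by (auto simp: bounded_iff)
    have cont2: "continuous_on (cball z r \<times> {0..1}) (\<lambda>p. ?f' (fst p) (snd p))"
    proof (intro continuous_on_mult continuous_on_compose2[OF powr] image_subsetI)
      fix p assume "p \<in> cball z r \<times> {0..1::real}"
      then show "1 - fst p * of_real (snd p) \<in> - \<real>\<^sub>\<le>\<^sub>0"
        using notneg[of "fst p" "snd p"] by (simp add: mem_Times_iff)
    qed (intro continuous_intros)+
    have "compact ((\<lambda>p. ?f' (fst p) (snd p)) ` (cball z r \<times> {0..1}))"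
      by (intro compact_continuous_image cont2 compact_Times) auto
    then obtain B where B: "\<And>w t. w \<in> cball z r \<Longrightarrow> t \<in> {0..1} \<Longrightarrow> norm (?f' w t) \<le> B"
      unfolding compact_eq_bounded_closed bounded_iff by (metis (no_types, lifting) SigmaI fst_conv image_eqI snd_conv)
    show "((\<lambda>z. \<integral>t. ?f z t \<partial>?K) has_field_derivative (\<integral>t. ?f' z t \<partial>?K)) (at z)"
    proof (rule has_field_derivative_integral_dominated[where r = r and w = "\<lambda>_. B"])
      show "integrable ?K (?f w)" if "w \<in> ball z r" for w
      proof -
        have c: "continuous_on {0..1} (?f w)" using that by (intro cont) auto
        then obtain B where "\<forall>t\<in>{0..1}. norm (?f w t) \<le> B" using bnd by blast
        then show ?thesis
          by (intro integrable_const_bound[where B = B] meas[OF c] AE_I2) simp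
      qed
      show "?f' z \<in> borel_measurable ?K" using r by (intro meas cont) auto
      show "((\<lambda>z. ?f z t) has_field_derivative ?f' w t) (at w)" if "w \<in> ball z r" "t \<in> space ?K" for w t
      proof -
        have "((\<lambda>u. u powr (- complex_of_real a)) has_field_derivative
            - of_real a * (1 - w * of_real t) powr (- of_real a - 1)) (at (1 - w * of_real t))"
          using that notneg[of w t] by (intro has_field_derivative_powr) auto
        moreover have "((\<lambda>w. 1 - w * of_real t) has_field_derivative - complex_of_real t) (at w)"
          by (auto intro!: derivative_eq_intros)
        ultimately have "((\<lambda>z. ?f z t) has_field_derivative
            - of_real a * (1 - w * of_real t) powr (- of_real a - 1) * - complex_of_real t) (at w)"
          by (rule DERIV_chain2)
        then show ?thesis by (simp add: mult_ac)
      qed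
      show "norm (?f' w t) \<le> B" if "w \<in> ball z r" "t \<in> space ?K" for w t
        using that by (intro B) auto
    qed (use r in auto)
  qed
qed

text \<open>On the disc, expand the power of 1 - zt by the binomial series and integrate term by
  term: the normalised moments Beta (b + n, c - b) / Beta (b, c - b) are the quotients of Pochhammer
  symbols (b)_n / (c)_n. \<open>hyp2F1_eqI\<close> carries the identity to all x < 1.\<close>

lemma hyp2F1_Euler_integral:
  assumes b: "0 < b" "b < c" and x: "x < 1"
  shows "hyp2F1 a b c x = Gamma c / (Gamma b * Gamma (c - b)) *
           (\<integral>t. (1 - x * t) powr (- a) \<partial>beta_measure b (c - b))"
proof -
  let ?K = "beta_measure b (c - b)"
  have fin: "finite_measure ?K" using b by (intro integral_power_beta_measure) auto
  interpret finite_measure ?K by fact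
  let ?C = "Gamma c / (Gamma b * Gamma (c - b))"
  let ?F = "\<lambda>z. complex_of_real ?C * (\<integral>t. (1 - z * of_real t) powr (- of_real a) \<partial>?K)"
  have Gpos: "Gamma b > 0" "Gamma (c - b) > 0" "Gamma c > 0" using b by auto
  have ser: "?F z = hyp2F1_series (of_real a) (of_real b) (of_real c) z" if z: "cmod z < 1" for z
  proof -
    let ?g = "\<lambda>n t. ((- complex_of_real a) gchoose n) * (- z * of_real t) ^ n"
    have mom: "integrable ?K (\<lambda>t. t ^ n)" for n
      by (rule integrable_const_bound[where B = 1]) (auto intro!: AE_I2 power_le_one borel_measurable_beta_measure simp: power_abs)
    have intg: "integrable ?K (?g n)" for n
    proof -
      have "integrable ?K (\<lambda>t. complex_of_real (t ^ n))" using mom[of n] by (rule integrable_of_real)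
      then have "integrable ?K (\<lambda>t. ((- complex_of_real a) gchoose n) * ((- z) ^ n * complex_of_real (t ^ n)))"
        by (intro integrable_mult_right)
      then show ?thesis by (simp only: power_mult_distrib of_real_power)
    qed
    have sm: "summable (\<lambda>n. norm (((- complex_of_real a) gchoose n) * (- z) ^ n))"
    proof -
      \<comment> \<open>Convergence of the binomial series at a radius strictly beyond |z| gives
        absolute convergence at z, and this series majorises all t in [0, 1] at once.\<close>
      obtain K where K: "cmod z < K" "K < 1" using dense[OF z] by auto
      have "summable (\<lambda>n. ((- complex_of_real a) gchoose n) * (of_real K) ^ n)"
        using gen_binomial_complex[of "of_real K" "- of_real a"] K norm_ge_zero[of z]
        by (auto simp: sums_iff simp del: norm_ge_zero)
      then have "summable (\<lambda>n. norm (((- complex_of_real a) gchoose n) * (- z) ^ n))"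
        by (rule powser_insidea) (use K norm_ge_zero[of z] in \<open>auto simp del: norm_ge_zero\<close>)
      then show ?thesis .
    qed
    have le: "norm (?g n t) \<le> norm (((- complex_of_real a) gchoose n) * (- z) ^ n)" if "t \<in> {0..1}" for n t
      using that by (auto simp: norm_mult norm_power power_mult_distrib intro!: mult_left_mono mult_right_le_one_le power_le_one)
    have sums: "(\<lambda>n. ?g n t) sums (1 - z * of_real t) powr (- of_real a)" if "t \<in> {0..1}" for t
    proof -
      have "cmod (- z * of_real t) < 1"
        using that z by (auto simp: norm_mult intro: le_less_trans[OF mult_right_le_one_le])
      from gen_binomial_complex[OF this, of "- of_real a"] show ?thesis by simp
    qed
    have "(\<lambda>n. \<integral>t. ?g n t \<partial>?K) sums (\<integral>t. (\<Sum>n. ?g n t) \<partial>?K)"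
    proof (rule sums_integral[OF intg])
      show "AE t in ?K. summable (\<lambda>n. norm (?g n t))"
        using le by (intro AE_I2 summable_comparison_test'[OF sm, of 0]) auto
      show "summable (\<lambda>n. \<integral>t. norm (?g n t) \<partial>?K)"
      proof (rule summable_comparison_test'[of _ 0])
        show "summable (\<lambda>n. measure ?K (space ?K) * norm (((- complex_of_real a) gchoose n) * (- z) ^ n))"
          by (intro summable_mult sm)
        show "norm (\<integral>t. norm (?g n t) \<partial>?K) \<le> measure ?K (space ?K) * norm (((- complex_of_real a) gchoose n) * (- z) ^ n)" for n
        proof -
          have "(\<integral>t. norm (?g n t) \<partial>?K) \<le> (\<integral>t. norm (((- complex_of_real a) gchoose n) * (- z) ^ n) \<partial>?K)"
            by (intro integral_mono integrable_norm intg) (use le in auto)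
          then show ?thesis by (simp add: mult.commute)
        qed
      qed
    qed
    also have "(\<integral>t. (\<Sum>n. ?g n t) \<partial>?K) = (\<integral>t. (1 - z * of_real t) powr (- of_real a) \<partial>?K)"
      using sums by (intro Bochner_Integration.integral_cong) (auto simp: sums_iff)
    finally have "(\<lambda>n. complex_of_real ?C * (\<integral>t. ?g n t \<partial>?K)) sums ?F z"
      by (rule sums_mult)
    also have "(\<lambda>n. complex_of_real ?C * (\<integral>t. ?g n t \<partial>?K)) =
        (\<lambda>n. pochhammer (of_real a) n * pochhammer (of_real b) n / (pochhammer (of_real c) n * fact n) * z ^ n)"
    proof
      fix n
      have "(\<integral>t. ?g n t \<partial>?K) = ((- complex_of_real a) gchoose n) * (- z) ^ n * (\<integral>t. complex_of_real (t ^ n) \<partial>?K)"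
        by (simp only: power_mult_distrib of_real_power mult.assoc integral_mult_right_zero)
      also have "(\<integral>t. complex_of_real (t ^ n) \<partial>?K) = of_real (Beta (b + real n) (c - b))"
        using b by (subst integral_complex_of_real) (simp add: integral_power_beta_measure)
      also have "((- complex_of_real a) gchoose n) * (- z) ^ n = pochhammer (of_real a) n / fact n * z ^ n"
        by (cases "even n") (simp_all add: gbinomial_pochhammer)
      finally have 1: "(\<integral>t. ?g n t \<partial>?K) = pochhammer (of_real a) n / fact n * z ^ n * of_real (Beta (b + real n) (c - b))" .
      have "?C * Beta (b + real n) (c - b) = pochhammer b n / pochhammer c n"
      proof -
        have "pochhammer b n = Gamma (b + real n) / Gamma b" "pochhammer c n = Gamma (c + real n) / Gamma c"
          using b by (auto intro!: pochhammer_Gamma simp: nonpos_Ints_def)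
        then show ?thesis using Gpos by (simp add: Beta_def mult.commute add.commute)
      qed
      then have "complex_of_real ?C * of_real (Beta (b + real n) (c - b)) = pochhammer (of_real b) n / pochhammer (of_real c) n"
        unfolding of_real_mult[symmetric] by (simp only: pochhammer_of_real of_real_divide)
      then show "complex_of_real ?C * (\<integral>t. ?g n t \<partial>?K) =
          pochhammer (of_real a) n * pochhammer (of_real b) n / (pochhammer (of_real c) n * fact n) * z ^ n"
        unfolding 1 mult.left_commute[of "complex_of_real ?C"] by (simp add: mult_ac)
    qed
    finally show ?thesis
      unfolding hyp2F1_series_def by (rule sums_unique)
  qed
  have "?F holomorphic_on slit_plane"
    by (intro holomorphic_on_mult holomorphic_on_const holomorphic_Euler_integral fin)
  then have "hyp2F1 a b c x = Re (?F (of_real x))" using ser x by (rule hyp2F1_eqI)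
  \<comment> \<open>The base 1 - xt is nonnegative on [0, 1], so the principal complex power is the
    real one.\<close>
  also have "(\<integral>t. (1 - complex_of_real x * of_real t) powr (- of_real a) \<partial>?K) =
     (\<integral>t. complex_of_real ((1 - x * t) powr (- a)) \<partial>?K)"
  proof (rule Bochner_Integration.integral_cong[OF refl])
    fix t assume "t \<in> space ?K"
    then have "x * t \<le> 1" using x mult_right_mono[of x 1 t] by auto
    then have "complex_of_real (1 - x * t) powr of_real (- a) = of_real ((1 - x * t) powr (- a))"
      by (intro powr_of_real) auto
    then show "(1 - complex_of_real x * of_real t) powr (- of_real a) = complex_of_real ((1 - x * t) powr (- a))"
      by simp
  qed
  finally show ?thesis by (simp add: integral_complex_of_real)
qed

section \<open>Path loss and Gamma integrals\<close>

text \<open>The layers are those of the unit exponential law, since 1 - exp (- c) is its mass on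
  [0, c]. After the discs are measured, w powr (- 2/\<alpha>) * exp (- w) is left to integrate;
  \<alpha> > 2 keeps the exponent above -1, whence Gamma (1 - 2/\<alpha>).\<close>

lemma nn_integral_one_minus_exp_path_loss:
  fixes y \<alpha> :: real
  assumes \<alpha>: "\<alpha> > 2" and y: "y \<ge> 0"
  shows "(\<integral>\<^sup>+x. ennreal (1 - exp (- (y * norm (x::real^2) powr (- \<alpha>)))) \<partial>lborel) =
    ennreal (pi * Gamma (1 - 2/\<alpha>) * y powr (2/\<alpha>))"
proof (cases "y = 0")
  case False
  with y have y: "y > 0" by simp
  let ?E = "erlang_density 0 1"
  have "(\<integral>\<^sup>+x. ennreal (1 - exp (- (y * norm (x::real^2) powr (- \<alpha>)))) \<partial>lborel) =
     (\<integral>\<^sup>+(x::real^2). (\<integral>\<^sup>+w. ennreal (?E w) * indicator {.. y * norm x powr (- \<alpha>)} w \<partial>lborel) \<partial>lborel)"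
    using y by (intro nn_integral_cong, subst nn_integral_erlang_density) (auto simp: erlang_CDF_def mult_less_0_iff)
  also have "\<dots> = (\<integral>\<^sup>+w. (\<integral>\<^sup>+(x::real^2). ennreal (?E w) * indicator {.. y * norm x powr (- \<alpha>)} w \<partial>lborel) \<partial>lborel)"
    by (rule lborel_pair.Fubini') (simp add: split_beta' indicator_def[abs_def])
  also have "\<dots> = (\<integral>\<^sup>+w. ennreal (pi * y powr (2/\<alpha>)) * ennreal (indicator {0..} w * w powr ((1 - 2/\<alpha>) - 1) / exp w) \<partial>lborel)"
  proof (intro nn_integral_cong_AE)
    have "AE w in lborel. (w::real) \<noteq> 0" by (rule AE_lborel_singleton)
    then show "AE w in lborel. (\<integral>\<^sup>+(x::real^2). ennreal (?E w) * indicator {.. y * norm x powr (- \<alpha>)} w \<partial>lborel) =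
      ennreal (pi * y powr (2/\<alpha>)) * ennreal (indicator {0..} w * w powr ((1 - 2/\<alpha>) - 1) / exp w)"
    proof eventually_elim
      fix w :: real assume "w \<noteq> 0"
      show "(\<integral>\<^sup>+(x::real^2). ennreal (?E w) * indicator {.. y * norm x powr (- \<alpha>)} w \<partial>lborel) =
        ennreal (pi * y powr (2/\<alpha>)) * ennreal (indicator {0..} w * w powr ((1 - 2/\<alpha>) - 1) / exp w)"
      proof (cases "w > 0")
        case w: True
        let ?r = "(y / w) powr (1/\<alpha>)"
        \<comment> \<open>The origin is removed from the disc because
          \<open>0 powr (- \<alpha>)\<close> is 0 here and not infinite; the point has area
          zero.\<close>
        have iff: "w \<le> y * norm x powr (- \<alpha>) \<longleftrightarrow> x \<in> cball 0 ?r - {0}" for x :: "real^2"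
        proof (cases "x = 0")
          case False
          then have "w \<le> y * norm x powr (- \<alpha>) \<longleftrightarrow> norm x powr \<alpha> \<le> y / w"
            using w by (simp add: powr_minus field_simps)
          also have "\<dots> \<longleftrightarrow> norm x powr \<alpha> \<le> ?r powr \<alpha>"
            using \<alpha> w y by (simp add: powr_powr)
          also have "\<dots> \<longleftrightarrow> norm x \<le> ?r"
            using \<alpha> powr_mono2[of \<alpha> "norm x" ?r] powr_less_mono2[of \<alpha> ?r "norm x"]
            by (meson less_le_trans linorder_not_le norm_ge_zero powr_ge_zero zero_less_numeral less_imp_le)
          finally show ?thesis using False by simp
        qed (use w in auto)
        have "(\<integral>\<^sup>+(x::real^2). ennreal (?E w) * indicator {.. y * norm x powr (- \<alpha>)} w \<partial>lborel) =
           (\<integral>\<^sup>+(x::real^2). ennreal (?E w) * indicator (cball 0 ?r - {0}) x \<partial>lborel)"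
          by (intro nn_integral_cong arg_cong2[of _ _ _ _ "(*)"] refl) (simp add: indicator_def iff)
        also have "\<dots> = ennreal (?E w) * emeasure lborel (cball (0::real^2) ?r - {0})"
          by (rule nn_integral_cmult_indicator) (simp add: sets.Diff)
        also have "emeasure lborel (cball (0::real^2) ?r - {0}) = emeasure lborel (cball (0::real^2) ?r)"
          by (rule emeasure_Diff_null_set) auto
        also have "\<dots> = ennreal (pi * ?r ^ 2)"
          using y w by (subst emeasure_cball) (simp_all add: unit_ball_vol_2)
        also have "?r ^ 2 = y powr (2/\<alpha>) * w powr (- (2/\<alpha>))"
        proof -
          have "?r ^ 2 = ?r powr (real 2)" using y w by (intro powr_realpow[symmetric]) auto
          also have "\<dots> = (y / w) powr (2/\<alpha>)" by (simp add: powr_powr)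
          finally show ?thesis using y w by (simp add: powr_divide powr_minus divide_simps)
        qed
        finally show ?thesis using w y
          by (simp add: erlang_density_def ennreal_mult[symmetric] exp_minus field_simps)
      qed (use \<open>w \<noteq> 0\<close> in \<open>auto simp: erlang_density_def\<close>)
    qed
  qed
  also have "\<dots> = ennreal (pi * y powr (2/\<alpha>)) * ennreal (Gamma (1 - 2/\<alpha>))"
  proof -
    have "1 - 2/\<alpha> > 0" using \<alpha> by simp
    then show ?thesis by (simp only: Gamma_conv_nn_integral_real) (rule nn_integral_cmult, simp)
  qed
  also have "\<dots> = ennreal (pi * Gamma (1 - 2/\<alpha>) * y powr (2/\<alpha>))"
    using \<alpha> by (simp add: ennreal_mult'[symmetric] mult_ac)
  finally show ?thesis .
qed simp

lemma nn_integral_Gamma_kernel: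
  assumes p: "p > 0" and m: "m > (0::real)"
  shows "(\<integral>\<^sup>+y. ennreal (indicator {0..} y * (y powr (p - 1) * exp (- (m * y)))) \<partial>lborel) =
    ennreal (Gamma p / m powr p)"
proof -
  let ?f = "\<lambda>t. ennreal (indicator {0..} t * t powr (p - 1) / exp t)"
  have "ennreal (Gamma p) = ennreal \<bar>m\<bar> * (\<integral>\<^sup>+y. ?f (0 + m * y) \<partial>lborel)"
    using m by (subst nn_integral_real_affine[of ?f m 0, symmetric]) (auto simp: Gamma_conv_nn_integral_real[OF p])
  also have "\<dots> = (\<integral>\<^sup>+y. ennreal (m powr p) * ennreal (indicator {0..} y * (y powr (p - 1) * exp (- (m * y)))) \<partial>lborel)"
    using m by (subst nn_integral_cmult[symmetric])
      (auto intro!: nn_integral_cong split: split_indicator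
         simp: ennreal_mult[symmetric] powr_mult powr_diff exp_minus field_simps mult_le_0_iff zero_le_mult_iff)
  also have "\<dots> = ennreal (m powr p) * (\<integral>\<^sup>+y. ennreal (indicator {0..} y * (y powr (p - 1) * exp (- (m * y)))) \<partial>lborel)"
    by (rule nn_integral_cmult) simp
  finally have "ennreal (1 / m powr p) * ennreal (Gamma p) = ennreal (1 / m powr p) * (ennreal (m powr p) * (\<integral>\<^sup>+y. ennreal (indicator {0..} y * (y powr (p - 1) * exp (- (m * y)))) \<partial>lborel))"
    by simp
  then show ?thesis using m p by (simp add: ennreal_mult'[symmetric] mult.assoc[symmetric])
qed

lemma gamma_density_nonneg: "m > 0 \<Longrightarrow> gamma_density m y \<ge> 0"
  by (simp add: gamma_density_def)

lemma borel_measurable_gamma_density [measurable]: "gamma_density m \<in> borel_measurable borel"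
  unfolding gamma_density_def[abs_def] by measurable

lemma nn_integral_gamma_density_powr:
  assumes m: "m > 0" and q: "q \<ge> 0"
  shows "(\<integral>\<^sup>+y. ennreal (gamma_density m y * y powr q) \<partial>lborel) = ennreal (Gamma (m + q) / (m powr q * Gamma m))"
proof -
  have "(\<integral>\<^sup>+y. ennreal (gamma_density m y * y powr q) \<partial>lborel) =
    (\<integral>\<^sup>+y. ennreal (m powr m / Gamma m) * ennreal (indicator {0..} y * (y powr (m + q - 1) * exp (- (m * y)))) \<partial>lborel)"
    using m by (intro nn_integral_cong)
      (auto simp: gamma_density_def ennreal_mult'[symmetric] powr_add powr_diff field_simps)
  also have "\<dots> = ennreal (m powr m / Gamma m) * ennreal (Gamma (m + q) / m powr (m + q))"
    using m q by (subst nn_integral_cmult) (simp_all add: nn_integral_Gamma_kernel)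
  also have "\<dots> = ennreal (Gamma (m + q) / (m powr q * Gamma m))"
    using m q by (subst ennreal_mult[symmetric]) (simp_all add: powr_add)
  finally show ?thesis .
qed

lemma nn_integral_gamma_density: "m > 0 \<Longrightarrow> (\<integral>\<^sup>+y. ennreal (gamma_density m y) \<partial>lborel) = 1"
proof -
  assume m: "m > 0"
  have "(\<integral>\<^sup>+y. ennreal (gamma_density m y) \<partial>lborel) = (\<integral>\<^sup>+y. ennreal (gamma_density m y * y powr 0) \<partial>lborel)"
    by (intro nn_integral_cong_AE eventually_mono[OF AE_lborel_singleton[of "0::real"]]) simp
  also have "\<dots> = 1" using m Gamma_real_pos[OF m, THEN less_imp_neq] by (subst nn_integral_gamma_density_powr) auto
  finally show ?thesis .
qed

text \<open>Polar-type coordinates \<open>x = S (1 - b)\<close>, \<open>y = S b\<close>: the sum is Gamma distributed and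
  the ratio is Beta distributed.\<close>
lemma nn_integral_gamma_density_combination:
  assumes m: "m > 0" and q: "q \<ge> 0" and u: "u > 0" and v: "v > 0"
  shows "(\<integral>\<^sup>+x. (\<integral>\<^sup>+y. ennreal (gamma_density m x * gamma_density m y * (u * x + v * y) powr q) \<partial>lborel) \<partial>lborel) =
    ennreal (Gamma (q + 2 * m) / m powr q * u powr q * hyp2F1_reg (- q) m (2 * m) (1 - v / u))"
proof -
  define F where "F x y = ennreal (gamma_density m x * gamma_density m y * (u * x + v * y) powr q)" for x y
  have [measurable]: "(\<lambda>p. F (fst p) (snd p)) \<in> borel_measurable (borel \<Otimes>\<^sub>M borel)"
    unfolding F_def by measurable
  \<comment> \<open>The square of the normalising constant \<open>m powr m / Gamma m\<close> of one
    density; its denominator cancels later against the prefactor of Euler's integral.\<close>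
  define K where "K = m powr (2 * m) / (Gamma m)\<^sup>2"
  let ?b = "\<lambda>b. indicator {0..1} b * (b powr (m - 1) * (1 - b) powr (m - 1) * (u * (1 - b) + v * b) powr q)"
  let ?g = "\<lambda>S. K * (indicator {0..} S * (S powr (q + 2 * m - 1) * exp (- (m * S))))"
  let ?I = "\<integral>\<^sup>+b. ennreal (?b b) \<partial>lborel"
  have Gpos: "Gamma m \<noteq> 0" "Gamma (2 * m) \<noteq> 0"
    using m by (simp_all add: Gamma_real_pos[THEN less_imp_neq, THEN not_sym])
  have K: "K > 0" using m unfolding K_def by (intro divide_pos_pos zero_less_power Gamma_real_pos) auto
  have "(\<integral>\<^sup>+x. (\<integral>\<^sup>+y. F x y \<partial>lborel) \<partial>lborel) = (\<integral>\<^sup>+x. (\<integral>\<^sup>+S. F x (S - x) \<partial>lborel) \<partial>lborel)"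
  proof (rule nn_integral_cong)
    fix x show "(\<integral>\<^sup>+y. F x y \<partial>lborel) = (\<integral>\<^sup>+S. F x (S - x) \<partial>lborel)"
      unfolding F_def by (subst nn_integral_real_affine[where c = 1 and t = "-x"]) simp_all
  qed
  also have "\<dots> = (\<integral>\<^sup>+S. (\<integral>\<^sup>+x. F x (S - x) \<partial>lborel) \<partial>lborel)"
    by (rule lborel_pair.Fubini') (simp add: split_beta' F_def)
  also have "\<dots> = (\<integral>\<^sup>+S. ennreal (?g S) * ?I \<partial>lborel)"
  proof (intro nn_integral_cong_AE)
    have "AE S in lborel. (S::real) \<noteq> 0" by (rule AE_lborel_singleton)
    then show "AE S in lborel. (\<integral>\<^sup>+x. F x (S - x) \<partial>lborel) = ennreal (?g S) * ?I"
    proof eventually_elim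
      fix S :: real assume "S \<noteq> 0"
      show "(\<integral>\<^sup>+x. F x (S - x) \<partial>lborel) = ennreal (?g S) * ?I"
      proof (cases "S > 0")
        case S: True
        have "(\<integral>\<^sup>+x. F x (S - x) \<partial>lborel) = ennreal \<bar>- S\<bar> * (\<integral>\<^sup>+b. F (S + - S * b) (S - (S + - S * b)) \<partial>lborel)"
          using S by (intro nn_integral_real_affine) (simp_all add: F_def)
        also have "\<dots> = (\<integral>\<^sup>+b. ennreal (?g S) * ennreal (?b b) \<partial>lborel)"
        proof (subst nn_integral_cmult[symmetric], simp add: F_def, rule nn_integral_cong)
          fix b :: real
          show "ennreal \<bar>- S\<bar> * F (S + - S * b) (S - (S + - S * b)) = ennreal (?g S) * ennreal (?b b)"
          proof (cases "b \<in> {0..1}")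
            case True
            have e: "S + - S * b = S * (1 - b)" "S - S * (1 - b) = S * b"
              "u * (S * (1 - b)) + v * (S * b) = S * (u * (1 - b) + v * b)"
              by (simp_all add: algebra_simps)
            \<comment> \<open>The powers of S are 1 from the Jacobian, m - 1 from each density and q
              from the combination. Their sum q + 2m - 1 makes a Gamma kernel of shape q +
              2m.\<close>
            have "S * (gamma_density m (S * (1 - b)) * gamma_density m (S * b) * (S * (u * (1 - b) + v * b)) powr q) =
                (m powr m * m powr m / (Gamma m)\<^sup>2) * (S * (S powr (m - 1) * S powr (m - 1) * S powr q)) *
                (exp (- (m * (S * (1 - b)))) * exp (- (m * (S * b)))) *
                (b powr (m - 1) * (1 - b) powr (m - 1) * (u * (1 - b) + v * b) powr q)"
              using True S m u v by (simp add: gamma_density_def powr_mult power2_eq_square mult_ac)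
            also have "S * (S powr (m - 1) * S powr (m - 1) * S powr q) = S powr 1 * (S powr (m - 1) * S powr (m - 1) * S powr q)"
              using S by simp
            also have "\<dots> = S powr (q + 2 * m - 1)"
              by (simp only: powr_add[symmetric]) (simp add: algebra_simps)
            also have "exp (- (m * (S * (1 - b)))) * exp (- (m * (S * b))) = exp (- (m * S))"
              by (simp add: exp_add[symmetric] algebra_simps)
            also have "m powr m * m powr m = m powr (2 * m)" by (simp flip: powr_add)
            finally have "S * (gamma_density m (S * (1 - b)) * gamma_density m (S * b) * (S * (u * (1 - b) + v * b)) powr q) = ?g S * ?b b"
              using True S by (simp add: K_def)
            then show ?thesis unfolding F_def e using S K
              by (simp add: ennreal_mult'[symmetric])
          next
            case False
            then have "S - S * b < 0 \<or> S * b < 0" using S by (auto simp: mult_less_0_iff)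
            then have "gamma_density m (S - S * b) * gamma_density m (S * b) = 0"
              by (auto simp: gamma_density_def)
            then show ?thesis using False by (auto simp: F_def)
          qed
        qed
        also have "\<dots> = ennreal (?g S) * ?I" by (rule nn_integral_cmult) simp
        finally show ?thesis .
      next
        case False
        with \<open>S \<noteq> 0\<close> have S: "S < 0" by simp
        then have "F x (S - x) = 0" for x by (auto simp: F_def gamma_density_def)
        then show ?thesis using S by simp
      qed
    qed
  qed
  also have "\<dots> = (\<integral>\<^sup>+S. ennreal (?g S) \<partial>lborel) * ?I"
    by (rule nn_integral_multc) simp
  also have "(\<integral>\<^sup>+S. ennreal (?g S) \<partial>lborel) = ennreal K * ennreal (Gamma (q + 2 * m) / m powr (q + 2 * m))"
    using K m q by (subst nn_integral_Gamma_kernel[symmetric])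
      (auto simp: ennreal_mult' nn_integral_cmult)
  \<comment> \<open>Pulling out u gives u(1 - b) + vb = u(1 - (1 - v/u) b), which is Euler's
    integrand at x = 1 - v/u; positivity of u and v gives x < 1.\<close>
  also have "?I = ennreal (u powr q) * (\<integral>\<^sup>+t. ennreal ((1 - (1 - v / u) * t) powr q) \<partial>beta_measure m m)"
  proof -
    have pos: "1 - (1 - v / u) * b \<ge> 0" if "b \<in> {0..1}" for b
    proof -
      have "1 - (1 - v / u) * b = (1 - b) + v / u * b" by (simp add: algebra_simps)
      moreover have "\<dots> \<ge> 0" using that u v by (intro add_nonneg_nonneg) auto
      ultimately show ?thesis by (simp only:)
    qed
    have split: "(u * (1 - b) + v * b) powr q = u powr q * (1 - (1 - v / u) * b) powr q" if "b \<in> {0..1}" for b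
    proof -
      have "u * (1 - b) + v * b = u * (1 - (1 - v / u) * b)" using u by (simp add: field_simps)
      then show ?thesis using u pos[OF that] by (simp only: powr_mult)
    qed
    have "ennreal (?b b) = ennreal (u powr q) * (indicator {0..1} b * ennreal (b powr (m - 1) * (1 - b) powr (m - 1)) *
        ennreal ((1 - (1 - v / u) * b) powr q))" for b
      unfolding indicator_def by (cases "b \<in> {0..1}") (simp_all add: split ennreal_mult[symmetric])
    then show ?thesis
      by (subst nn_integral_beta_measure, simp, subst nn_integral_cmult[symmetric], simp, intro nn_integral_cong)
  qed
  also have "(\<integral>\<^sup>+t. ennreal ((1 - (1 - v / u) * t) powr q) \<partial>beta_measure m m) =
      ennreal (\<integral>t. (1 - (1 - v / u) * t) powr q \<partial>beta_measure m m)"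
  proof (rule nn_integral_eq_integral)
    interpret finite_measure "beta_measure m m" using m by (intro integral_power_beta_measure)
    show "integrable (beta_measure m m) (\<lambda>t. (1 - (1 - v / u) * t) powr q)"
    proof (rule integrable_const_bound[where B = "(1 + \<bar>1 - v / u\<bar>) powr q"])
      show "AE t in beta_measure m m. norm ((1 - (1 - v / u) * t) powr q) \<le> (1 + \<bar>1 - v / u\<bar>) powr q"
      proof (rule AE_I2)
        fix t assume "t \<in> space (beta_measure m m)"
        then have t: "0 \<le> t" "t \<le> 1" by auto
        have "\<bar>(1 - v / u) * t\<bar> \<le> \<bar>1 - v / u\<bar>" using t by (simp add: abs_mult mult_right_le_one_le)
        then have 1: "1 - (1 - v / u) * t \<le> 1 + \<bar>1 - v / u\<bar>" by linarith
        have "(1 - v / u) * t \<le> 1 * 1" using t u v by (intro mult_mono) auto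
        then have 2: "0 \<le> 1 - (1 - v / u) * t" by simp
        show "norm ((1 - (1 - v / u) * t) powr q) \<le> (1 + \<bar>1 - v / u\<bar>) powr q"
          using powr_mono2[OF q 2 1] by simp
      qed
    qed (rule borel_measurable_beta_measure, simp)
  qed simp
  also have "(\<integral>t. (1 - (1 - v / u) * t) powr q \<partial>beta_measure m m) =
      (Gamma m)\<^sup>2 * hyp2F1_reg (- q) m (2 * m) (1 - v / u)"
    using m u v hyp2F1_Euler_integral[of m "2 * m" "1 - v / u" "- q"] Gpos
    by (simp add: hyp2F1_reg_def power2_eq_square)
  also have "ennreal K * ennreal (Gamma (q + 2 * m) / m powr (q + 2 * m)) *
      (ennreal (u powr q) * ennreal ((Gamma m)\<^sup>2 * hyp2F1_reg (- q) m (2 * m) (1 - v / u))) =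
     ennreal (Gamma (q + 2 * m) / m powr q * u powr q * hyp2F1_reg (- q) m (2 * m) (1 - v / u))"
    using m q Gpos by (simp add: ennreal_mult'[symmetric] K_def powr_add mult_ac)
  finally show ?thesis unfolding F_def .
qed

section \<open>The Laplace functional of the Poisson process\<close>

text \<open>The map exp (- a) on [0, \<infinity>] with value 0 at \<infinity>. It allows Laplace
  transforms of sums to be computed before these are known to be finite.\<close>

definition exp_neg :: "ennreal \<Rightarrow> real" where
  "exp_neg a = (if a = \<top> then 0 else exp (- enn2real a))"

lemma borel_measurable_exp_neg [measurable]: "exp_neg \<in> borel_measurable borel"
  unfolding exp_neg_def[abs_def] by measurable

lemma exp_neg_ennreal: "x \<ge> 0 \<Longrightarrow> exp_neg (ennreal x) = exp (- x)"
  by (simp add: exp_neg_def)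

lemma exp_neg_nonneg: "exp_neg a \<ge> 0" and exp_neg_le_1: "exp_neg a \<le> 1"
  by (auto simp: exp_neg_def)

lemma exp_neg_add: "exp_neg (a + b) = exp_neg a * exp_neg b"
  by (cases a; cases b) (auto simp: exp_neg_def exp_add[symmetric] simp flip: ennreal_plus)

lemma tendsto_exp_neg:
  assumes "(g \<longlongrightarrow> a) F"
  shows "((\<lambda>x. exp_neg (g x)) \<longlongrightarrow> exp_neg a) F"
proof (cases "a = \<top>")
  case False
  then obtain r where r: "a = ennreal r" "r \<ge> 0" by (cases a) auto
  have "eventually (\<lambda>x. g x < \<top>) F"
    using assms False by (intro order_tendstoD) (auto simp: less_top)
  then have "eventually (\<lambda>x. exp (- enn2real (g x)) = exp_neg (g x)) F"
    by eventually_elim (auto simp: exp_neg_def)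
  moreover have "((\<lambda>x. exp (- enn2real (g x))) \<longlongrightarrow> exp (- r)) F"
    using assms r by (intro tendsto_intros tendsto_enn2real) auto
  ultimately show ?thesis using r by (simp add: exp_neg_ennreal filterlim_cong)
next
  case True
  show ?thesis
    unfolding tendsto_iff
  proof (intro allI impI)
    fix e :: real assume e: "e > 0"
    \<comment> \<open>Beyond - ln e the exponential is below e; the maximum with 0 keeps the
      threshold meaningful as an \<open>ennreal\<close>.\<close>
    let ?K = "max 0 (- ln e)"
    have "eventually (\<lambda>x. g x > ennreal ?K) F"
      using assms True by (intro order_tendstoD) auto
    then show "eventually (\<lambda>x. dist (exp_neg (g x)) (exp_neg a) < e) F"
    proof eventually_elim
      fix x assume x: "g x > ennreal ?K"
      show "dist (exp_neg (g x)) (exp_neg a) < e"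
      proof (cases "g x")
        case (real r)
        with x have "r > ?K" by (simp only: ennreal_less_iff max.cobounded1)
        then have "r > - ln e" by simp
        then have "exp (- r) < exp (ln e)" by (subst exp_less_cancel_iff) simp
        with e real True show ?thesis by (simp add: exp_neg_def)
      qed (use e True in \<open>simp add: exp_neg_def\<close>)
    qed
  qed
qed

lemma (in prob_space) Poisson_Laplace_transform:
  fixes N :: "'a \<Rightarrow> nat"
  assumes [measurable]: "N \<in> measurable M (count_space UNIV)" and \<mu>: "\<mu> \<ge> 0"
    and P: "\<And>k. prob {\<omega> \<in> space M. N \<omega> = k} = \<mu> ^ k / fact k * exp (- \<mu>)"
  shows "expectation (\<lambda>\<omega>. exp (- (c * real (N \<omega>)))) = exp (- (\<mu> * (1 - exp (- c))))"
proof -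
  have "(\<integral>\<^sup>+\<omega>. ennreal (exp (- (c * real (N \<omega>)))) \<partial>M) =
      (\<integral>\<^sup>+\<omega>. (\<Sum>k. ennreal (exp (- (c * real k))) * indicator {\<omega> \<in> space M. N \<omega> = k} \<omega>) \<partial>M)"
  proof (rule nn_integral_cong)
    fix \<omega> assume "\<omega> \<in> space M"
    then have "(\<Sum>k. ennreal (exp (- (c * real k))) * indicator {\<omega> \<in> space M. N \<omega> = k} \<omega>) =
       (\<Sum>k\<in>{N \<omega>}. ennreal (exp (- (c * real k))) * indicator {\<omega> \<in> space M. N \<omega> = k} \<omega>)"
      by (intro suminf_finite) auto
    with \<open>\<omega> \<in> space M\<close> show "ennreal (exp (- (c * real (N \<omega>)))) =
       (\<Sum>k. ennreal (exp (- (c * real k))) * indicator {\<omega> \<in> space M. N \<omega> = k} \<omega>)" by simp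
  qed
  also have "\<dots> = (\<Sum>k. ennreal (exp (- (c * real k))) * emeasure M {\<omega> \<in> space M. N \<omega> = k})"
    by (subst nn_integral_suminf) (auto intro!: suminf_cong nn_integral_cmult_indicator)
  also have "\<dots> = (\<Sum>k. ennreal (exp (- \<mu>) * ((\<mu> * exp (- c)) ^ k /\<^sub>R fact k)))"
    using \<mu> by (intro suminf_cong)
      (simp add: emeasure_eq_measure P ennreal_mult'[symmetric] power_mult_distrib exp_of_nat_mult[symmetric] field_simps)
  also have "\<dots> = ennreal (exp (- \<mu>) * exp (\<mu> * exp (- c)))"
    using \<mu> by (intro suminf_ennreal_eq sums_mult exp_converges) auto
  also have "exp (- \<mu>) * exp (\<mu> * exp (- c)) = exp (- (\<mu> * (1 - exp (- c))))"
    by (simp add: exp_add[symmetric] algebra_simps)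
  finally show ?thesis
    by (intro integral_eq_nn_integral[THEN trans]) auto
qed

text \<open>The sum over the points is a linear combination of the counts in the level sets of s.
  These sets are bounded and disjoint, so the counts are independent Poisson variables and their
  transforms multiply.\<close>

lemma (in prob_space) PPP_Laplace_functional_simple:
  fixes X :: "nat \<Rightarrow> 'a \<Rightarrow> real^2" and s :: "real^2 \<Rightarrow> real"
  assumes PPP: "is_PPP M lam X" and lam: "lam \<ge> 0"
    and s: "simple_function lborel s" "\<And>x. s x \<ge> 0" and bdd: "bounded {x. s x \<noteq> 0}"
  shows "expectation (\<lambda>\<omega>. exp_neg (\<Sum>i. ennreal (s (X i \<omega>)))) = exp (- (lam * (\<integral>x. 1 - exp (- s x) \<partial>lborel)))"
proof -
  \<comment> \<open>The level 0 is left out: its level set is unbounded, and \<open>is_PPP\<close>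
    describes counts in bounded sets only.\<close>
  define V where "V = range s - {0}"
  have "finite V" using s by (auto simp: V_def simple_function_def)
  then obtain e where e: "bij_betw e {..<card V} V"
    using ex_bij_betw_nat_finite[of V] by (auto simp: atLeast0LessThan)
  define n where "n = card V"
  define B where "B j = s -` {e j}" for j
  define N where "N j = count_in X (B j)" for j
  have eV: "e j \<in> V" if "j < n" for j using e that by (auto simp: bij_betw_def n_def)
  have e_pos: "e j > 0" if "j < n" for j
    using eV[OF that] s(2) by (force simp: V_def less_le)
  have e_inj: "e j = e k \<longleftrightarrow> j = k" if "j < n" "k < n" for j k
    using e that by (auto simp: bij_betw_def n_def inj_on_eq_iff)
  have B_sets: "B j \<in> sets lborel" for j
    using simple_functionD(2)[OF s(1), of "{e j}"] by (simp add: B_def)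
  have B_bdd: "bounded (B j)" if "j < n" for j
    by (rule bounded_subset[OF bdd]) (use e_pos[OF that] in \<open>auto simp: B_def\<close>)
  have B_disj: "disjoint_family_on B {..<n}"
    using e_inj by (auto simp: disjoint_family_on_def B_def)
  have s_eq: "s x = (\<Sum>j<n. e j * indicator (B j) x)" and
    s_eq': "1 - exp (- s x) = (\<Sum>j<n. (1 - exp (- e j)) * indicator (B j) x)" for x
  proof -
    \<comment> \<open>Stated for every g with g 0 = 0, so that it expands both s and 1 - exp (- s)
      over the level sets.\<close>
    have *: "g (s x) = (\<Sum>j<n. g (e j) * indicator (B j) x)" if "g 0 = 0" for g :: "real \<Rightarrow> real"
    proof (cases "s x = 0")
      case True
      then have "x \<notin> B j" if "j < n" for j using e_pos[OF that] by (auto simp: B_def)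
      then show ?thesis using True that by simp
    next
      case False
      then obtain k where k: "k < n" "s x = e k"
        using e by (auto simp: V_def bij_betw_def n_def image_iff set_eq_iff)
      then have "(\<Sum>j<n. g (e j) * indicator (B j) x) = (\<Sum>j<n. if j = k then g (e k) else 0)"
        using e_inj by (intro sum.cong) (auto simp: B_def indicator_def)
      then show ?thesis using k by simp
    qed
    show "s x = (\<Sum>j<n. e j * indicator (B j) x)" using *[of "\<lambda>y. y"] by simp
    show "1 - exp (- s x) = (\<Sum>j<n. (1 - exp (- e j)) * indicator (B j) x)"
      using *[of "\<lambda>y. 1 - exp (- y)"] by simp
  qed
  have fin: "AE \<omega> in M. finite {i. X i \<omega> \<in> B j}"
    and Poi: "prob {\<omega> \<in> space M. N j \<omega> = k} = (lam * measure lborel (B j)) ^ k / fact k * exp (- (lam * measure lborel (B j)))"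
    if "j < n" for j k
  proof -
    have "\<forall>B. B \<in> sets lborel \<and> bounded B \<longrightarrow>
        (AE \<omega> in M. finite {i. X i \<omega> \<in> B}) \<and>
        (\<forall>k::nat. measure M {\<omega>\<in>space M. count_in X B \<omega> = k} =
            (lam * measure lborel B) ^ k / fact k * exp (- (lam * measure lborel B)))"
      using PPP unfolding is_PPP_def by (elim conjE)
    from this[rule_format, OF conjI[OF B_sets[of j] B_bdd[OF that]]]
    show "AE \<omega> in M. finite {i. X i \<omega> \<in> B j}"
      "prob {\<omega> \<in> space M. N j \<omega> = k} = (lam * measure lborel (B j)) ^ k / fact k * exp (- (lam * measure lborel (B j)))"
      unfolding N_def by simp_all
  qed
  have "\<forall>(Bs :: nat \<Rightarrow> (real^2) set) n.
        (\<forall>j<n. Bs j \<in> sets lborel \<and> bounded (Bs j)) \<and> disjoint_family_on Bs {..<n} \<longrightarrow>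
        indep_vars (\<lambda>_. count_space UNIV) (\<lambda>j. count_in X (Bs j)) {..<n}"
    using PPP unfolding is_PPP_def by (elim conjE)
  then have ind: "indep_vars (\<lambda>_. count_space UNIV) N {..<n}"
    using B_sets B_bdd B_disj unfolding N_def by simp
  have N_meas: "N j \<in> measurable M (count_space UNIV)" if "j < n" for j
    using ind that by (auto simp: indep_vars_def)
  \<comment> \<open>\<open>count_in\<close> is a cardinality and would be 0 for an infinite set, so
    only with finiteness does it count the points.\<close>
  have "AE \<omega> in M. \<forall>j\<in>{..<n}. finite {i. X i \<omega> \<in> B j}"
    using fin by (intro AE_finite_allI) auto
  then have AE: "AE \<omega> in M. exp_neg (\<Sum>i. ennreal (s (X i \<omega>))) = (\<Prod>j<n. exp (- (e j * real (N j \<omega>))))"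
  proof eventually_elim
    fix \<omega> assume f: "\<forall>j\<in>{..<n}. finite {i. X i \<omega> \<in> B j}"
    have "(\<Sum>i. ennreal (s (X i \<omega>))) = (\<Sum>i\<in>(\<Union>j<n. {i. X i \<omega> \<in> B j}). ennreal (s (X i \<omega>)))"
      using f by (intro suminf_finite) (auto simp: s_eq)
    also have "\<dots> = ennreal (\<Sum>i\<in>(\<Union>j<n. {i. X i \<omega> \<in> B j}). s (X i \<omega>))"
      using s(2) by (intro sum_ennreal) auto
    also have "(\<Sum>i\<in>(\<Union>j<n. {i. X i \<omega> \<in> B j}). s (X i \<omega>)) = (\<Sum>j<n. \<Sum>i\<in>{i. X i \<omega> \<in> B j}. s (X i \<omega>))"
      using f e_inj by (intro sum.UNION_disjoint) (auto simp: B_def)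
    also have "\<dots> = (\<Sum>j<n. e j * real (N j \<omega>))"
      by (intro sum.cong) (auto simp: B_def N_def count_in_def)
    finally have eq: "(\<Sum>i. ennreal (s (X i \<omega>))) = ennreal (\<Sum>j<n. e j * real (N j \<omega>))" .
    show "exp_neg (\<Sum>i. ennreal (s (X i \<omega>))) = (\<Prod>j<n. exp (- (e j * real (N j \<omega>))))"
      unfolding eq by (subst exp_neg_ennreal) (auto intro!: sum_nonneg mult_nonneg_nonneg less_imp_le[OF e_pos] simp: exp_sum[symmetric] sum_negf)
  qed
  have [measurable]: "s \<in> borel_measurable borel" using s(1) borel_measurable_simple_function by force
  have [measurable]: "X i \<in> borel_measurable M" for i using PPP by (auto simp: is_PPP_def)
  have "expectation (\<lambda>\<omega>. exp_neg (\<Sum>i. ennreal (s (X i \<omega>)))) = expectation (\<lambda>\<omega>. \<Prod>j<n. exp (- (e j * real (N j \<omega>))))"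
    using AE by (intro integral_cong_AE) (use N_meas in measurable)
  also have "\<dots> = (\<Prod>j<n. expectation (\<lambda>\<omega>. exp (- (e j * real (N j \<omega>)))))"
  proof (rule indep_vars_lebesgue_integral)
    show "indep_vars (\<lambda>_. borel) (\<lambda>j \<omega>. exp (- (e j * real (N j \<omega>)))) {..<n}"
      by (rule indep_vars_compose2[OF ind]) auto
    show "integrable M (\<lambda>\<omega>. exp (- (e j * real (N j \<omega>))))" if "j \<in> {..<n}" for j
      using that e_pos[of j] N_meas[of j] by (intro integrable_const_bound[where B = 1]) auto
  qed simp
  also have "\<dots> = (\<Prod>j<n. exp (- ((lam * measure lborel (B j)) * (1 - exp (- e j)))))"
    using lam Poi N_meas by (intro prod.cong refl Poisson_Laplace_transform) auto
  also have "\<dots> = exp (- (lam * (\<Sum>j<n. (1 - exp (- e j)) * measure lborel (B j))))"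
    by (simp add: exp_sum[symmetric] sum_negf sum_distrib_left mult_ac)
  also have "(\<Sum>j<n. (1 - exp (- e j)) * measure lborel (B j)) = (\<integral>x. 1 - exp (- s x) \<partial>lborel)"
    unfolding s_eq' using B_sets emeasure_bounded_finite[OF B_bdd]
    by (subst Bochner_Integration.integral_sum) (auto intro!: integrable_real_mult_indicator integrable_mult_right integrable_real_indicator)
  finally show ?thesis .
qed

text \<open>Approximation from below by simple functions cut off outside growing balls, since
  supports must be bounded. On the left the bound 1 dominates; on the right 1 - exp (- f) does, by
  the integrability hypothesis.\<close>

lemma (in prob_space) PPP_Laplace_functional:
  fixes X :: "nat \<Rightarrow> 'a \<Rightarrow> real^2" and f :: "real^2 \<Rightarrow> real"
  assumes PPP: "is_PPP M lam X" and lam: "lam \<ge> 0"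
    and f [measurable]: "f \<in> borel_measurable borel" and nonneg: "\<And>x. f x \<ge> 0"
    and int: "integrable lborel (\<lambda>x. 1 - exp (- f x))"
  shows "expectation (\<lambda>\<omega>. exp_neg (\<Sum>i. ennreal (f (X i \<omega>)))) = exp (- (lam * (\<integral>x. 1 - exp (- f x) \<partial>lborel)))"
proof -
  have [measurable]: "X i \<in> borel_measurable M" for i using PPP by (auto simp: is_PPP_def)
  have "(\<lambda>x. ennreal (f x)) \<in> borel_measurable lborel" by simp
  from borel_measurable_implies_simple_function_sequence'[OF this] obtain s where
    s: "\<And>i. simple_function lborel (s i)" "incseq s" "\<And>i x. s i x < \<top>" "\<And>x. (SUP i. s i x) = ennreal (f x)"
    by blast
  define g where "g n x = enn2real (s n x) * indicator (ball 0 (real n)) x" for n x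
  have g_simple: "simple_function lborel (g n)" for n
    unfolding g_def by (intro simple_function_mult simple_function_compose1[OF s(1), where g = enn2real] simple_function_indicator) auto
  have g_nonneg: "g n x \<ge> 0" for n x by (simp add: g_def)
  have g_bdd: "bounded {x. g n x \<noteq> 0}" for n
    by (rule bounded_subset[OF bounded_ball[of 0 "real n"]]) (auto simp: g_def indicator_def split: if_splits)
  have s_le: "s m x \<le> s n x" if "m \<le> n" for m n x using s(2) that by (auto simp: incseq_def le_fun_def)
  have g_mono: "g m x \<le> g n x" if "m \<le> n" for m n x
    unfolding g_def using that s_le[OF that] s(3)[of n x]
    by (intro mult_mono) (auto intro!: enn2real_mono split: split_indicator)
  have g_lim: "(\<lambda>n. g n x) \<longlonglongrightarrow> f x" for x
  proof -
    have "(\<lambda>n. s n x) \<longlonglongrightarrow> ennreal (f x)"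
      unfolding s(4)[symmetric] using s_le by (intro LIMSEQ_SUP) (auto simp: incseq_def)
    then have "(\<lambda>n. enn2real (s n x)) \<longlonglongrightarrow> f x" using nonneg by (intro tendsto_enn2real) auto
    moreover have "eventually (\<lambda>n. enn2real (s n x) = g n x) sequentially"
    proof -
      obtain k where "norm x < real k" using reals_Archimedean2 by blast
      then show ?thesis by (auto simp: g_def eventually_sequentially intro!: exI[of _ k])
    qed
    ultimately show ?thesis by (simp add: filterlim_cong)
  qed
  have g_le: "g n x \<le> f x" for n x
    by (rule incseq_le[OF _ g_lim]) (use g_mono in \<open>auto simp: incseq_def\<close>)
  have [measurable]: "g n \<in> borel_measurable borel" for n
    using g_simple[of n] borel_measurable_simple_function by force
  have "(\<lambda>n. expectation (\<lambda>\<omega>. exp_neg (\<Sum>i. ennreal (g n (X i \<omega>))))) \<longlonglongrightarrow>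
     expectation (\<lambda>\<omega>. exp_neg (\<Sum>i. ennreal (f (X i \<omega>))))"
  proof (rule integral_dominated_convergence[where w = "\<lambda>_. 1"])
    show "AE \<omega> in M. (\<lambda>n. exp_neg (\<Sum>i. ennreal (g n (X i \<omega>)))) \<longlonglongrightarrow> exp_neg (\<Sum>i. ennreal (f (X i \<omega>)))"
    proof (intro AE_I2 tendsto_exp_neg)
      fix \<omega>
      have "ennreal (f x) = (SUP n. ennreal (g n x))" for x
        using g_mono g_lim[of x] by (intro LIMSEQ_unique[OF tendsto_ennrealI[OF g_lim[of x]] LIMSEQ_SUP]) (auto simp: incseq_def intro!: ennreal_leI)
      then have "(\<Sum>i. ennreal (f (X i \<omega>))) = (SUP n. \<Sum>i. ennreal (g n (X i \<omega>)))"
        using g_mono by (subst ennreal_suminf_SUP_eq[symmetric]) (auto simp: incseq_def intro!: ennreal_leI)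
      then show "(\<lambda>n. \<Sum>i. ennreal (g n (X i \<omega>))) \<longlonglongrightarrow> (\<Sum>i. ennreal (f (X i \<omega>)))"
        using g_mono by (auto intro!: LIMSEQ_SUP simp: incseq_def suminf_le ennreal_leI)
    qed
  qed (use exp_neg_nonneg exp_neg_le_1 in auto)
  moreover have "(\<lambda>n. \<integral>x. 1 - exp (- g n x) \<partial>lborel) \<longlonglongrightarrow> (\<integral>x. 1 - exp (- f x) \<partial>lborel)"
  proof (intro integral_dominated_convergence[where w = "\<lambda>x. 1 - exp (- f x)"] int AE_I2)
    show "(\<lambda>n. 1 - exp (- g n x)) \<longlonglongrightarrow> 1 - exp (- f x)" for x
      by (intro tendsto_intros g_lim)
    show "norm (1 - exp (- g n x)) \<le> 1 - exp (- f x)" for n x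
      using g_le[of n x] g_nonneg[of n x] by simp
  qed auto
  then have "(\<lambda>n. exp (- (lam * (\<integral>x. 1 - exp (- g n x) \<partial>lborel)))) \<longlonglongrightarrow>
      exp (- (lam * (\<integral>x. 1 - exp (- f x) \<partial>lborel)))"
    by (intro tendsto_intros)
  moreover have "expectation (\<lambda>\<omega>. exp_neg (\<Sum>i. ennreal (g n (X i \<omega>)))) = exp (- (lam * (\<integral>x. 1 - exp (- g n x) \<partial>lborel)))" for n
    by (rule PPP_Laplace_functional_simple[OF PPP lam g_simple g_nonneg g_bdd])
  ultimately show ?thesis by (auto intro: LIMSEQ_unique)
qed

section \<open>The Laplace transform of the interference\<close>

text \<open>Equal to (1 + q/m) powr (- m), the Laplace transform at q of the Gamma law with shape m
  and mean 1.\<close>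

definition gamma_laplace :: "real \<Rightarrow> real \<Rightarrow> real" where
  "gamma_laplace m q = (m / (m + q)) powr m"

lemma borel_measurable_gamma_laplace [measurable]: "gamma_laplace m \<in> borel_measurable borel"
  unfolding gamma_laplace_def[abs_def] by measurable

lemma gamma_laplace_pos: "m > 0 \<Longrightarrow> q \<ge> 0 \<Longrightarrow> gamma_laplace m q > 0"
  and gamma_laplace_le_1: "m > 0 \<Longrightarrow> q \<ge> 0 \<Longrightarrow> gamma_laplace m q \<le> 1"
  by (auto simp: gamma_laplace_def intro!: powr_le1)

lemma nn_integral_gamma_density_exp:
  assumes m: "m > 0" and q: "q \<ge> 0"
  shows "(\<integral>\<^sup>+y. ennreal (gamma_density m y * exp (- (q * y))) \<partial>lborel) = ennreal (gamma_laplace m q)"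
proof -
  have "(\<integral>\<^sup>+y. ennreal (gamma_density m y * exp (- (q * y))) \<partial>lborel) =
    (\<integral>\<^sup>+y. ennreal (m powr m / Gamma m) * ennreal (indicator {0..} y * (y powr (m - 1) * exp (- ((m + q) * y)))) \<partial>lborel)"
    using m by (intro nn_integral_cong)
      (auto simp: gamma_density_def ennreal_mult'[symmetric] exp_add[symmetric] algebra_simps)
  also have "\<dots> = ennreal (m powr m / Gamma m) * ennreal (Gamma m / (m + q) powr m)"
    using m q by (subst nn_integral_cmult) (simp_all add: nn_integral_Gamma_kernel)
  also have "\<dots> = ennreal (gamma_laplace m q)"
    using m q Gamma_real_pos[OF m, THEN less_imp_neq]
    by (subst ennreal_mult[symmetric]) (simp_all add: gamma_laplace_def powr_divide)
  finally show ?thesis .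
qed

text \<open>The constant c stands for the factor of the other branch, so that both fading variables
  can be integrated out in turn: c is first an exponential of one of them, then the Laplace factor
  of the other.\<close>

lemma nn_integral_gamma_density_one_minus_exp:
  assumes m: "m > 0" and q: "q \<ge> 0" and c: "0 \<le> c" "c \<le> 1"
  shows "(\<integral>\<^sup>+y. ennreal (gamma_density m y * (1 - c * exp (- (q * y)))) \<partial>lborel) = ennreal (1 - c * gamma_laplace m q)"
proof -
  have "(\<integral>\<^sup>+y. ennreal (gamma_density m y * (1 - c * exp (- (q * y)))) \<partial>lborel) =
    (\<integral>\<^sup>+y. ennreal (gamma_density m y) - ennreal c * ennreal (gamma_density m y * exp (- (q * y))) \<partial>lborel)"
    using c gamma_density_nonneg[OF m]
    by (intro nn_integral_cong) (simp add: ennreal_mult'[symmetric] ennreal_minus algebra_simps)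
  also have "\<dots> = (\<integral>\<^sup>+y. ennreal (gamma_density m y) \<partial>lborel) - (\<integral>\<^sup>+y. ennreal c * ennreal (gamma_density m y * exp (- (q * y))) \<partial>lborel)"
  proof (rule nn_integral_diff)
    show "(\<integral>\<^sup>+y. ennreal c * ennreal (gamma_density m y * exp (- (q * y))) \<partial>lborel) \<noteq> \<infinity>"
      by (simp add: nn_integral_cmult nn_integral_gamma_density_exp m q ennreal_mult_eq_top_iff)
    have "c * (gamma_density m y * exp (- (q * y))) \<le> gamma_density m y" for y
    proof (cases "y \<ge> 0")
      case True
      then have "c * exp (- (q * y)) \<le> 1" using c q by (intro mult_le_one) auto
      from mult_left_mono[OF this gamma_density_nonneg[OF m, of y]] show ?thesis by (simp add: mult_ac)
    qed (simp add: gamma_density_def)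
    then show "AE y in lborel. ennreal c * ennreal (gamma_density m y * exp (- (q * y))) \<le> ennreal (gamma_density m y)"
      using c by (auto simp: ennreal_mult'[symmetric] intro!: ennreal_leI)
  qed auto
  also have "(\<integral>\<^sup>+y. ennreal c * ennreal (gamma_density m y * exp (- (q * y))) \<partial>lborel) = ennreal (c * gamma_laplace m q)"
    by (subst nn_integral_cmult) (simp_all add: nn_integral_gamma_density_exp m q c ennreal_mult')
  also have "(\<integral>\<^sup>+y. ennreal (gamma_density m y) \<partial>lborel) - ennreal (c * gamma_laplace m q) = ennreal (1 - c * gamma_laplace m q)"
    using c gamma_laplace_pos[OF m q]
    by (simp add: nn_integral_gamma_density m ennreal_1[symmetric] ennreal_minus del: ennreal_1)
  finally show ?thesis .
qed

text \<open>Both branches have the same distance to the point x, so undoing the two transforms gives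
  one exponential with coefficient ua + vb. Integrating over the plane first applies the path loss
  integral with y = ua + vb and leaves the moment of order 2/\<alpha>.\<close>

lemma nn_integral_one_minus_gamma_laplace_path_loss:
  assumes m: "m > 0" and \<alpha>: "\<alpha> > 2" and u: "u \<ge> 0" and v: "v \<ge> 0"
  shows "(\<integral>\<^sup>+x. ennreal (1 - gamma_laplace m (u * norm (x::real^2) powr (- \<alpha>)) * gamma_laplace m (v * norm x powr (- \<alpha>))) \<partial>lborel) =
    ennreal (pi * Gamma (1 - 2/\<alpha>)) *
      (\<integral>\<^sup>+a. (\<integral>\<^sup>+b. ennreal (gamma_density m a * gamma_density m b * (u * a + v * b) powr (2/\<alpha>)) \<partial>lborel) \<partial>lborel)"
proof -
  let ?g = "gamma_density m" and ?p = "\<lambda>x::real^2. norm x powr (- \<alpha>)"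
  let ?F = "\<lambda>x a b. ennreal (?g a * ?g b * (1 - exp (- ((u * a + v * b) * ?p x))))"
  have G: "?g y \<ge> 0" for y by (rule gamma_density_nonneg[OF m])
  have "(\<integral>\<^sup>+x. ennreal (1 - gamma_laplace m (u * ?p x) * gamma_laplace m (v * ?p x)) \<partial>lborel) =
     (\<integral>\<^sup>+x. (\<integral>\<^sup>+a. (\<integral>\<^sup>+b. ?F x a b \<partial>lborel) \<partial>lborel) \<partial>lborel)"
  proof (rule nn_integral_cong)
    fix x :: "real^2"
    have "(\<integral>\<^sup>+b. ?F x a b \<partial>lborel) = ennreal (?g a * (1 - gamma_laplace m (v * ?p x) * exp (- ((u * ?p x) * a))))" for a
    proof (cases "a \<ge> 0")
      case True
      have "(\<integral>\<^sup>+b. ?F x a b \<partial>lborel) = (\<integral>\<^sup>+b. ennreal (?g a) * ennreal (?g b * (1 - exp (- ((u * ?p x) * a)) * exp (- ((v * ?p x) * b)))) \<partial>lborel)"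
        using G by (intro nn_integral_cong) (simp add: ennreal_mult'[symmetric] exp_add[symmetric] algebra_simps)
      also have "\<dots> = ennreal (?g a) * ennreal (1 - exp (- ((u * ?p x) * a)) * gamma_laplace m (v * ?p x))"
        using True u v m by (subst nn_integral_cmult) (simp_all add: nn_integral_gamma_density_one_minus_exp)
      finally show ?thesis using G by (simp add: ennreal_mult'[symmetric] mult.commute)
    qed (simp add: gamma_density_def)
    then show "ennreal (1 - gamma_laplace m (u * ?p x) * gamma_laplace m (v * ?p x)) = (\<integral>\<^sup>+a. (\<integral>\<^sup>+b. ?F x a b \<partial>lborel) \<partial>lborel)"
      using u v m
      by (simp only:, subst nn_integral_gamma_density_one_minus_exp)
         (auto simp: gamma_laplace_le_1 gamma_laplace_pos less_imp_le mult.commute)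
  qed
  also have "\<dots> = (\<integral>\<^sup>+a. (\<integral>\<^sup>+x. (\<integral>\<^sup>+b. ?F x a b \<partial>lborel) \<partial>lborel) \<partial>lborel)"
    by (rule lborel_pair.Fubini') simp
  also have "\<dots> = (\<integral>\<^sup>+a. (\<integral>\<^sup>+b. (\<integral>\<^sup>+x. ?F x a b \<partial>lborel) \<partial>lborel) \<partial>lborel)"
    by (intro nn_integral_cong lborel_pair.Fubini') simp
  also have "\<dots> = (\<integral>\<^sup>+a. (\<integral>\<^sup>+b. ennreal (pi * Gamma (1 - 2/\<alpha>)) * ennreal (?g a * ?g b * (u * a + v * b) powr (2/\<alpha>)) \<partial>lborel) \<partial>lborel)"
  proof (intro nn_integral_cong)
    fix a b :: real
    show "(\<integral>\<^sup>+x. ?F x a b \<partial>lborel) = ennreal (pi * Gamma (1 - 2/\<alpha>)) * ennreal (?g a * ?g b * (u * a + v * b) powr (2/\<alpha>))"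
    proof (cases "a \<ge> 0 \<and> b \<ge> 0")
      case True
      then have "u * a + v * b \<ge> 0" using u v by simp
      note * = nn_integral_one_minus_exp_path_loss[OF \<alpha> this]
      have "(\<integral>\<^sup>+x. ?F x a b \<partial>lborel) = ennreal (?g a * ?g b) * ennreal (pi * Gamma (1 - 2/\<alpha>) * (u * a + v * b) powr (2/\<alpha>))"
        using G by (subst *[symmetric], subst nn_integral_cmult[symmetric]) (auto simp: ennreal_mult'[symmetric])
      also have "\<dots> = ennreal (pi * Gamma (1 - 2/\<alpha>)) * ennreal (?g a * ?g b * (u * a + v * b) powr (2/\<alpha>))"
        using G \<alpha> by (simp add: ennreal_mult'[symmetric] mult_ac)
      finally show ?thesis .
    qed (auto simp: gamma_density_def)
  qed
  also have "\<dots> = ennreal (pi * Gamma (1 - 2/\<alpha>)) *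
      (\<integral>\<^sup>+a. (\<integral>\<^sup>+b. ennreal (?g a * ?g b * (u * a + v * b) powr (2/\<alpha>)) \<partial>lborel) \<partial>lborel)"
    by (simp add: nn_integral_cmult)
  finally show ?thesis .
qed

text \<open>Unlike \<open>indep_var\<close>, the two random variables may have different value types.\<close>
definition (in prob_space) indep_rv ::
  "'b measure \<Rightarrow> ('a \<Rightarrow> 'b) \<Rightarrow> 'c measure \<Rightarrow> ('a \<Rightarrow> 'c) \<Rightarrow> bool" where
  "indep_rv S A T B \<longleftrightarrow> A \<in> measurable M S \<and> B \<in> measurable M T \<and>
     (\<forall>P\<in>sets S. \<forall>Q\<in>sets T. prob ((A -` P \<inter> space M) \<inter> (B -` Q \<inter> space M)) =
        prob (A -` P \<inter> space M) * prob (B -` Q \<inter> space M))"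

lemma (in prob_space) indep_rv_compose:
  assumes ind: "indep_rv S A T B" and f: "f \<in> measurable S S'" and k: "k \<in> measurable T T'"
  shows "indep_rv S' (\<lambda>\<omega>. f (A \<omega>)) T' (\<lambda>\<omega>. k (B \<omega>))"
  unfolding indep_rv_def
proof (intro conjI ballI)
  have A: "A \<in> measurable M S" and B: "B \<in> measurable M T" using ind by (auto simp: indep_rv_def)
  show "(\<lambda>\<omega>. f (A \<omega>)) \<in> measurable M S'" "(\<lambda>\<omega>. k (B \<omega>)) \<in> measurable M T'"
    using A B f k by (auto intro: measurable_compose)
  fix P Q assume PQ: "P \<in> sets S'" "Q \<in> sets T'"
  have eq: "(\<lambda>\<omega>. f (A \<omega>)) -` P \<inter> space M = A -` (f -` P \<inter> space S) \<inter> space M"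
    "(\<lambda>\<omega>. k (B \<omega>)) -` Q \<inter> space M = B -` (k -` Q \<inter> space T) \<inter> space M"
    using measurable_space[OF A] measurable_space[OF B] by auto
  have "f -` P \<inter> space S \<in> sets S" "k -` Q \<inter> space T \<in> sets T"
    using PQ f k by (auto intro: measurable_sets)
  then show "prob (((\<lambda>\<omega>. f (A \<omega>)) -` P \<inter> space M) \<inter> ((\<lambda>\<omega>. k (B \<omega>)) -` Q \<inter> space M)) =
      prob ((\<lambda>\<omega>. f (A \<omega>)) -` P \<inter> space M) * prob ((\<lambda>\<omega>. k (B \<omega>)) -` Q \<inter> space M)"
    unfolding eq using ind unfolding indep_rv_def by blast
qed

lemma (in prob_space) indep_var_imp_indep_rv: "indep_var S A T B \<Longrightarrow> indep_rv S A T B"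
  unfolding indep_rv_def
proof (intro conjI ballI)
  assume ind: "indep_var S A T B"
  show "A \<in> measurable M S" "B \<in> measurable M T"
    using ind by (rule indep_var_rv1 indep_var_rv2)+
  fix P Q assume "P \<in> sets S" "Q \<in> sets T"
  moreover have "(A -` P \<inter> space M) \<inter> (B -` Q \<inter> space M) = (\<lambda>x. (A x, B x)) -` (P \<times> Q) \<inter> space M" by auto
  ultimately show "prob ((A -` P \<inter> space M) \<inter> (B -` Q \<inter> space M)) =
        prob (A -` P \<inter> space M) * prob (B -` Q \<inter> space M)"
    using indep_varD[OF ind] by simp
qed

text \<open>Fubini for the product law of the pair, written back as two separate draws \<omega>' and
  \<omega> from \<open>M\<close>. This replaces conditioning on \<open>B\<close>: its value is
  frozen in the inner integral.\<close>

lemma (in prob_space) nn_integral_indep_rv: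
  assumes ind: "indep_rv S A T B" and F [measurable]: "F \<in> borel_measurable (S \<Otimes>\<^sub>M T)"
  shows "(\<integral>\<^sup>+\<omega>. F (A \<omega>, B \<omega>) \<partial>M) = (\<integral>\<^sup>+\<omega>. (\<integral>\<^sup>+\<omega>'. F (A \<omega>', B \<omega>) \<partial>M) \<partial>M)"
proof -
  have [measurable]: "A \<in> measurable M S" "B \<in> measurable M T"
    using ind by (auto simp: indep_rv_def)
  interpret A: prob_space "distr M S A" by (rule prob_space_distr) simp
  interpret B: prob_space "distr M T B" by (rule prob_space_distr) simp
  interpret AB: pair_sigma_finite "distr M S A" "distr M T B" ..
  have "(\<integral>\<^sup>+\<omega>. F (A \<omega>, B \<omega>) \<partial>M) = (\<integral>\<^sup>+p. F p \<partial>distr M (S \<Otimes>\<^sub>M T) (\<lambda>\<omega>. (A \<omega>, B \<omega>)))"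
    by (subst nn_integral_distr) auto
  also have "distr M (S \<Otimes>\<^sub>M T) (\<lambda>\<omega>. (A \<omega>, B \<omega>)) = distr M S A \<Otimes>\<^sub>M distr M T B"
  proof (rule pair_measure_eqI[symmetric])
    fix P Q assume "P \<in> sets (distr M S A)" "Q \<in> sets (distr M T B)"
    moreover have "(\<lambda>\<omega>. (A \<omega>, B \<omega>)) -` (P \<times> Q) \<inter> space M = (A -` P \<inter> space M) \<inter> (B -` Q \<inter> space M)" by auto
    ultimately show "emeasure (distr M S A) P * emeasure (distr M T B) Q =
        emeasure (distr M (S \<Otimes>\<^sub>M T) (\<lambda>\<omega>. (A \<omega>, B \<omega>))) (P \<times> Q)"
      using ind by (simp add: emeasure_distr emeasure_eq_measure indep_rv_def ennreal_mult')
  qed (simp_all add: A.sigma_finite_measure_axioms B.sigma_finite_measure_axioms cong: sets_pair_measure_cong)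
  also have "(\<integral>\<^sup>+p. F p \<partial>(distr M S A \<Otimes>\<^sub>M distr M T B)) = (\<integral>\<^sup>+b. (\<integral>\<^sup>+a. F (a, b) \<partial>distr M S A) \<partial>distr M T B)"
    by (subst AB.nn_integral_snd) simp_all
  also have "\<dots> = (\<integral>\<^sup>+b. (\<integral>\<^sup>+\<omega>'. F (A \<omega>', b) \<partial>M) \<partial>distr M T B)"
    by (intro nn_integral_cong) (subst nn_integral_distr, auto)
  also have "\<dots> = (\<integral>\<^sup>+\<omega>. (\<integral>\<^sup>+\<omega>'. F (A \<omega>', B \<omega>) \<partial>M) \<partial>M)"
    by (subst nn_integral_distr) auto
  finally show ?thesis .
qed

section \<open>The marked Poisson model and the joint Laplace transform of its interference\<close>

locale mrc_model = prob_space M for M :: "'a measure" +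
  fixes X :: "nat \<Rightarrow> 'a \<Rightarrow> real^2"
    and g :: "nat \<Rightarrow> 'a \<Rightarrow> real"
    and h :: "nat \<Rightarrow> nat \<Rightarrow> 'a \<Rightarrow> real"
    and lam \<alpha> mI :: real
    and mD :: nat
  assumes lam: "lam > 0" and alpha: "\<alpha> > 2" and mD: "mD \<ge> 1" and mI: "mI > 0"
    and PPP: "is_PPP M lam X"
    and g_distr: "\<And>n. n \<in> {1,2} \<Longrightarrow> distributed M lborel (g n) (\<lambda>y. ennreal (gamma_density (real mD) y))"
    and h_distr: "\<And>n i. n \<in> {1,2} \<Longrightarrow> distributed M lborel (h n i) (\<lambda>y. ennreal (gamma_density mI y))"
    and marks_indep: "indep_vars (\<lambda>_. borel)
        (\<lambda>j. case j of Inl n \<Rightarrow> g n | Inr (n, i) \<Rightarrow> h n i)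
        (Inl ` {1,2} \<union> Inr ` ({1,2} \<times> UNIV))"
    and marks_indep_PPP: "indep_set
        (sigma_sets (space M)
          {(\<lambda>\<omega>. \<lambda>j\<in>Inl ` {1,2} \<union> Inr ` ({1,2} \<times> UNIV).
              (case j of Inl n \<Rightarrow> g n \<omega> | Inr (n, i) \<Rightarrow> h n i \<omega>)) -` A \<inter> space M
           | A. A \<in> sets (Pi\<^sub>M (Inl ` {1,2} \<union> Inr ` ({1,2} \<times> UNIV)) (\<lambda>_. (borel :: real measure)))})
        (sigma_sets (space M)
          {(\<lambda>\<omega> i. X i \<omega>) -` B \<inter> space M
           | B. B \<in> sets (Pi\<^sub>M (UNIV :: nat set) (\<lambda>_. (borel :: (real^2) measure)))})"
begin

\<comment> \<open>keeps the index set \<open>{1,2}\<close> from being rewritten to \<open>{Suc 0,2}\<close>\<close>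
declare One_nat_def [simp del]

abbreviation fading_index :: "(nat + nat \<times> nat) set" where
  "fading_index \<equiv> Inr ` ({1,2} \<times> UNIV)"

abbreviation mark_index :: "(nat + nat \<times> nat) set" where
  "mark_index \<equiv> Inl ` {1,2} \<union> fading_index"

definition mark :: "nat + nat \<times> nat \<Rightarrow> 'a \<Rightarrow> real" where
  "mark j \<omega> = (case j of Inl n \<Rightarrow> g n \<omega> | Inr (n, i) \<Rightarrow> h n i \<omega>)"

definition fading :: "'a \<Rightarrow> nat + nat \<times> nat \<Rightarrow> real" where
  "fading \<omega> = (\<lambda>j\<in>fading_index. mark j \<omega>)"

definition locations :: "'a \<Rightarrow> nat \<Rightarrow> real^2" where
  "locations \<omega> = (\<lambda>i. X i \<omega>)"

text \<open>The interference without the factor \<open>d powr \<alpha>\<close>. Taken in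
  \<open>ennreal\<close>, the sum always exists; taken as a function of configurations and not of
  \<omega>, it can be evaluated with fading and locations from different draws.\<close>

definition shot_noise :: "nat \<Rightarrow> (nat + nat \<times> nat \<Rightarrow> real) \<times> (nat \<Rightarrow> real^2) \<Rightarrow> ennreal" where
  "shot_noise n p = (\<Sum>i. ennreal (fst p (Inr (n, i)) * norm (snd p i) powr (- \<alpha>)))"

lemma X_measurable [measurable]: "X i \<in> borel_measurable M"
  using PPP by (simp add: is_PPP_def)

lemma indep_mark: "indep_vars (\<lambda>_. borel) mark mark_index"
proof -
  have "(\<lambda>j. case j of Inl n \<Rightarrow> g n | Inr (n, i) \<Rightarrow> h n i) = mark"
    by (auto simp: fun_eq_iff mark_def split: sum.split)
  then show ?thesis using marks_indep by simp
qed

lemma mark_measurable: "j \<in> mark_index \<Longrightarrow> mark j \<in> borel_measurable M"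
  using indep_mark by (auto simp: indep_vars_def)

lemma locations_measurable [measurable]: "locations \<in> measurable M (Pi\<^sub>M UNIV (\<lambda>_. borel))"
  unfolding locations_def by (rule measurable_PiM_single') auto

lemma fading_measurable [measurable]: "fading \<in> measurable M (Pi\<^sub>M fading_index (\<lambda>_. borel))"
  unfolding fading_def by (rule measurable_restrict) (auto intro: mark_measurable)

lemma indep_marks_locations:
  "indep_rv (Pi\<^sub>M mark_index (\<lambda>_. borel)) (\<lambda>\<omega>. \<lambda>j\<in>mark_index. mark j \<omega>) (Pi\<^sub>M UNIV (\<lambda>_. borel)) locations"
  unfolding indep_rv_def
proof (intro conjI ballI)
  show "(\<lambda>\<omega>. \<lambda>j\<in>mark_index. mark j \<omega>) \<in> measurable M (Pi\<^sub>M mark_index (\<lambda>_. borel))"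
    by (rule measurable_restrict) (rule mark_measurable)
  fix P :: "(nat + nat \<times> nat \<Rightarrow> real) set" and Q :: "(nat \<Rightarrow> real^2) set"
  assume PQ: "P \<in> sets (Pi\<^sub>M mark_index (\<lambda>_. borel))" "Q \<in> sets (Pi\<^sub>M UNIV (\<lambda>_. borel))"
  have "indep_set
      (sigma_sets (space M) {(\<lambda>\<omega>. \<lambda>j\<in>mark_index. mark j \<omega>) -` A \<inter> space M |A. A \<in> sets (Pi\<^sub>M mark_index (\<lambda>_. borel))})
      (sigma_sets (space M) {locations -` A \<inter> space M |A. A \<in> sets (Pi\<^sub>M UNIV (\<lambda>_. borel))})"
    using marks_indep_PPP unfolding mark_def locations_def[abs_def] .
  then show "prob (((\<lambda>\<omega>. \<lambda>j\<in>mark_index. mark j \<omega>) -` P \<inter> space M) \<inter> (locations -` Q \<inter> space M)) =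
     prob ((\<lambda>\<omega>. \<lambda>j\<in>mark_index. mark j \<omega>) -` P \<inter> space M) * prob (locations -` Q \<inter> space M)"
    by (rule indep_setD) (use PQ in \<open>auto intro!: sigma_sets.Basic\<close>)
qed simp

lemma indep_fading_locations: "indep_rv (Pi\<^sub>M fading_index (\<lambda>_. borel)) fading (Pi\<^sub>M UNIV (\<lambda>_. borel)) locations"
proof -
  have "indep_rv (Pi\<^sub>M fading_index (\<lambda>_. borel)) (\<lambda>\<omega>. restrict (\<lambda>j\<in>mark_index. mark j \<omega>) fading_index)
      (Pi\<^sub>M UNIV (\<lambda>_. borel)) (\<lambda>\<omega>. locations \<omega>)"
    by (rule indep_rv_compose[OF indep_marks_locations]) (rule measurable_restrict_subset, blast, simp)
  also have "(\<lambda>\<omega>. restrict (\<lambda>j\<in>mark_index. mark j \<omega>) fading_index) = fading"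
    by (auto simp: fun_eq_iff fading_def)
  finally show ?thesis .
qed

lemma shot_noise_measurable [measurable]:
  assumes "n \<in> {1,2}"
  shows "shot_noise n \<in> borel_measurable (Pi\<^sub>M fading_index (\<lambda>_. borel) \<Otimes>\<^sub>M Pi\<^sub>M UNIV (\<lambda>_. borel))"
proof -
  have [measurable]: "(\<lambda>p. fst p (Inr (n, i))) \<in> borel_measurable (Pi\<^sub>M fading_index (\<lambda>_. borel :: real measure) \<Otimes>\<^sub>M Pi\<^sub>M UNIV (\<lambda>_. borel :: (real^2) measure))" for i
    by (rule measurable_compose[OF measurable_fst measurable_component_singleton]) (use assms in auto)
  have [measurable]: "(\<lambda>p. snd p i) \<in> borel_measurable (Pi\<^sub>M fading_index (\<lambda>_. borel :: real measure) \<Otimes>\<^sub>M Pi\<^sub>M UNIV (\<lambda>_. borel :: (real^2) measure))" for i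
    by (rule measurable_compose[OF measurable_snd measurable_component_singleton]) auto
  show ?thesis unfolding shot_noise_def[abs_def] by measurable
qed

lemma h_measurable [measurable]: "n \<in> {1,2} \<Longrightarrow> h n i \<in> borel_measurable M"
  using distributed_measurable[OF h_distr] by simp

lemma AE_h_nonneg: "AE \<omega> in M. \<forall>n\<in>{1,2}. \<forall>i. h n i \<omega> \<ge> 0"
proof -
  have "AE \<omega> in M. h n i \<omega> \<ge> 0" if "n \<in> {1,2}" for n i
    by (subst distributed_AE2[OF h_distr[OF that]]) (auto simp: gamma_density_def)
  then show ?thesis by (auto simp: AE_all_countable)
qed

lemma expectation_exp_h:
  assumes n: "n \<in> {1,2}" and q: "q \<ge> 0"
  shows "expectation (\<lambda>\<omega>. exp (- (q * h n i \<omega>))) = gamma_laplace mI q"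
proof -
  have "(\<integral>\<^sup>+\<omega>. ennreal (exp (- (q * h n i \<omega>))) \<partial>M) = (\<integral>\<^sup>+y. ennreal (gamma_density mI y) * ennreal (exp (- (q * y))) \<partial>lborel)"
    by (subst distributed_nn_integral[OF h_distr[OF n]]) auto
  also have "\<dots> = ennreal (gamma_laplace mI q)"
    using nn_integral_gamma_density_exp[OF mI q] gamma_density_nonneg[OF mI] by (simp add: ennreal_mult'[symmetric])
  finally show ?thesis
    using n gamma_laplace_pos[OF mI q] by (subst integral_eq_nn_integral) auto
qed

text \<open>For frozen locations the exponential factorises over independent fading variables. The
  product rule covers finitely many of them, so the first n interferers are treated and n tends to
  infinity. Writing the product through - ln gives the shape of a sum over points of a nonnegative
  function, ready for the Laplace functional.\<close>

lemma expectation_exp_shot_noise_given_locations: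
  assumes u: "u \<ge> 0" and v: "v \<ge> 0"
  shows "expectation (\<lambda>\<omega>. exp_neg (ennreal u * shot_noise 1 (fading \<omega>, x) + ennreal v * shot_noise 2 (fading \<omega>, x))) =
    exp_neg (\<Sum>i. ennreal (- ln (gamma_laplace mI (u * norm (x i) powr (- \<alpha>)) * gamma_laplace mI (v * norm (x i) powr (- \<alpha>)))))"
proof -
  define p where "p i = norm (x i) powr (- \<alpha>)" for i
  have p: "p i \<ge> 0" for i by (simp add: p_def)
  define w where "w n = (if n = 1 then u else v)" for n :: nat
  have w: "w n \<ge> 0" for n using u v by (simp add: w_def)
  \<comment> \<open>The coefficient of each fading variable in u times the first shot noise plus v
    times the second.\<close>
  define c where "c j = (case j of Inl (_::nat) \<Rightarrow> 0 | Inr (n, i) \<Rightarrow> w n * p i)" for j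
  let ?L = "gamma_laplace mI"
  let ?K = "\<lambda>n. Inr ` ({1,2} \<times> {..<n}) :: (nat + nat \<times> nat) set"
  let ?P = "\<lambda>n \<omega>. \<Prod>j\<in>?K n. exp (- (c j * mark j \<omega>))"
  have prod_K: "(\<Prod>j\<in>?K n. f j) = (\<Prod>i<n. f (Inr (1, i))) * (\<Prod>i<n. f (Inr (2, i)))" for n and f :: "_ \<Rightarrow> real"
  proof -
    have "(\<Prod>j\<in>?K n. f j) = (\<Prod>(k, i)\<in>{1,2} \<times> {..<n}. f (Inr (k, i)))"
      by (subst prod.reindex) (auto simp: comp_def split_beta')
    also have "\<dots> = (\<Prod>k\<in>{1,2}. \<Prod>i<n. f (Inr (k, i)))" by (rule prod.cartesian_product[symmetric])
    finally show ?thesis by simp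
  qed
  have meas: "mark j \<in> borel_measurable M" if "j \<in> ?K n" for j n
    using that by (intro mark_measurable) auto
  have lim1: "(\<lambda>n. expectation (?P n)) \<longlonglongrightarrow>
      expectation (\<lambda>\<omega>. exp_neg (ennreal u * shot_noise 1 (fading \<omega>, x) + ennreal v * shot_noise 2 (fading \<omega>, x)))"
  proof (rule integral_dominated_convergence[where w = "\<lambda>_. 1"])
    have [measurable]: "(\<lambda>\<omega>. shot_noise n (fading \<omega>, x)) \<in> borel_measurable M" if "n \<in> {1,2}" for n
      by (rule measurable_compose[OF measurable_Pair[OF fading_measurable measurable_const] shot_noise_measurable[OF that]])
         (simp add: space_PiM)
    show "(\<lambda>\<omega>. exp_neg (ennreal u * shot_noise 1 (fading \<omega>, x) + ennreal v * shot_noise 2 (fading \<omega>, x))) \<in> borel_measurable M"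
      by measurable (auto simp: space_PiM)
    show "?P n \<in> borel_measurable M" for n
      using meas[of _ n] by measurable
    show "AE \<omega> in M. norm (?P n \<omega>) \<le> 1" for n
      using AE_h_nonneg
    proof eventually_elim
      fix \<omega> assume *: "\<forall>n\<in>{1,2}. \<forall>i. h n i \<omega> \<ge> 0"
      show "norm (?P n \<omega>) \<le> 1"
        unfolding prod_norm[symmetric]
        by (intro prod_le_1) (use * w p in \<open>auto simp: c_def mark_def\<close>)
    qed
    show "AE \<omega> in M. (\<lambda>n. ?P n \<omega>) \<longlonglongrightarrow> exp_neg (ennreal u * shot_noise 1 (fading \<omega>, x) + ennreal v * shot_noise 2 (fading \<omega>, x))"
      using AE_h_nonneg
    proof eventually_elim
      fix \<omega> assume *: "\<forall>n\<in>{1,2}. \<forall>i. h n i \<omega> \<ge> 0"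
      let ?S = "\<lambda>n k. \<Sum>i<n. ennreal (h k i \<omega> * p i)"
      have S_eq: "ennreal (w k) * ?S n k = ennreal (\<Sum>i<n. w k * p i * h k i \<omega>)" if "k \<in> {1,2}" for k n
      proof -
        have "h k i \<omega> \<ge> 0" for i using * that by auto
        then show ?thesis using w[of k] p
          by (subst sum_ennreal[symmetric]) (auto simp: sum_distrib_left ennreal_mult'[symmetric] mult_ac)
      qed
      have "?P n \<omega> = exp_neg (ennreal u * ?S n 1 + ennreal v * ?S n 2)" for n
      proof -
        have "exp_neg (ennreal (w 1) * ?S n 1 + ennreal (w 2) * ?S n 2) = exp (- (\<Sum>i<n. w 1 * p i * h 1 i \<omega>)) * exp (- (\<Sum>i<n. w 2 * p i * h 2 i \<omega>))"
          using * w p by (simp only: exp_neg_add S_eq insertI1 insertI2) (subst exp_neg_ennreal, auto intro!: sum_nonneg)+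
        then show ?thesis
          unfolding prod_K by (simp add: c_def mark_def exp_sum[symmetric] sum_negf w_def)
      qed
      moreover have "(\<lambda>n. ?S n k) \<longlonglongrightarrow> shot_noise k (fading \<omega>, x)" if "k \<in> {1,2}" for k
      proof -
        have "shot_noise k (fading \<omega>, x) = (\<Sum>i. ennreal (h k i \<omega> * p i))"
          using that by (auto simp: shot_noise_def fading_def mark_def p_def)
        then show ?thesis by (simp add: summable_LIMSEQ summableI)
      qed
      ultimately show "(\<lambda>n. ?P n \<omega>) \<longlonglongrightarrow> exp_neg (ennreal u * shot_noise 1 (fading \<omega>, x) + ennreal v * shot_noise 2 (fading \<omega>, x))"
        by (auto intro!: tendsto_exp_neg tendsto_add ennreal_tendsto_cmult)
    qed
  qed simp
  have f_nonneg: "- ln (?L (u * p i) * ?L (v * p i)) \<ge> 0" for i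
    using u v p[of i] gamma_laplace_pos[OF mI, of "u * p i"] gamma_laplace_le_1[OF mI, of "u * p i"]
     gamma_laplace_pos[OF mI, of "v * p i"] gamma_laplace_le_1[OF mI, of "v * p i"]
    by (auto intro!: mult_le_one)
  have eqn: "expectation (?P n) = exp_neg (\<Sum>i<n. ennreal (- ln (?L (u * p i) * ?L (v * p i))))" for n
  proof -
    have "expectation (?P n) = (\<Prod>j\<in>?K n. expectation (\<lambda>\<omega>. exp (- (c j * mark j \<omega>))))"
    proof (rule indep_vars_lebesgue_integral)
      show "indep_vars (\<lambda>_. borel) (\<lambda>j \<omega>. exp (- (c j * mark j \<omega>))) (?K n)"
        by (rule indep_vars_compose2[OF indep_vars_subset[OF indep_mark]]) auto
      show "integrable M (\<lambda>\<omega>. exp (- (c j * mark j \<omega>)))" if j: "j \<in> ?K n" for j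
      proof (rule integrable_const_bound[where B = 1])
        show "AE \<omega> in M. norm (exp (- (c j * mark j \<omega>))) \<le> 1"
          using AE_h_nonneg by eventually_elim (use j w p in \<open>auto simp: c_def mark_def\<close>)
      qed (use meas[OF j] in measurable)
    qed simp
    also have "\<dots> = (\<Prod>i<n. ?L (u * p i) * ?L (v * p i))"
      unfolding prod_K using u v p by (simp add: c_def mark_def w_def expectation_exp_h prod.distrib)
    also have "\<dots> = exp (- (\<Sum>i<n. - ln (?L (u * p i) * ?L (v * p i))))"
      using u v p gamma_laplace_pos[OF mI] by (simp add: sum_negf exp_sum)
    also have "\<dots> = exp_neg (\<Sum>i<n. ennreal (- ln (?L (u * p i) * ?L (v * p i))))"
      using f_nonneg by (simp add: exp_neg_ennreal sum_nonneg)
    finally show ?thesis .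
  qed
  have "(\<lambda>n. exp_neg (\<Sum>i<n. ennreal (- ln (?L (u * p i) * ?L (v * p i))))) \<longlonglongrightarrow> exp_neg (\<Sum>i. ennreal (- ln (?L (u * p i) * ?L (v * p i))))"
    by (intro tendsto_exp_neg summable_LIMSEQ summableI)
  with lim1 show ?thesis unfolding eqn p_def by (rule LIMSEQ_unique)
qed

text \<open>The fractional moment enters only through its value C, so that one lemma serves both
  cases of \<open>A_fun\<close>: the hypergeometric value for positive u and v, and the moment of a
  single Gamma variable when u or v is 0.\<close>

lemma shot_noise_Laplace_transform:
  assumes u: "u \<ge> 0" and v: "v \<ge> 0" and C: "C \<ge> 0"
    and C_eq: "(\<integral>\<^sup>+a. (\<integral>\<^sup>+b. ennreal (gamma_density mI a * gamma_density mI b * (u * a + v * b) powr (2/\<alpha>)) \<partial>lborel) \<partial>lborel) = ennreal C"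
  shows "expectation (\<lambda>\<omega>. exp_neg (ennreal u * shot_noise 1 (fading \<omega>, locations \<omega>) + ennreal v * shot_noise 2 (fading \<omega>, locations \<omega>))) =
    exp (- (lam * (pi * Gamma (1 - 2/\<alpha>) * C)))"
proof -
  let ?L = "\<lambda>x::real^2. gamma_laplace mI (u * norm x powr (- \<alpha>)) * gamma_laplace mI (v * norm x powr (- \<alpha>))"
  let ?F = "\<lambda>p. exp_neg (ennreal u * shot_noise 1 p + ennreal v * shot_noise 2 p)"
  have L: "?L x > 0" "?L x \<le> 1" for x
    using u v by (auto intro!: mult_pos_pos mult_le_one gamma_laplace_pos gamma_laplace_le_1 mI less_imp_le[OF gamma_laplace_pos])
  have [measurable]: "?F \<in> borel_measurable (Pi\<^sub>M fading_index (\<lambda>_. borel) \<Otimes>\<^sub>M Pi\<^sub>M UNIV (\<lambda>_. borel))"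
    by measurable
  have nn: "(\<integral>\<^sup>+x. ennreal (1 - ?L x) \<partial>lborel) = ennreal (pi * Gamma (1 - 2/\<alpha>) * C)"
    using alpha C by (subst nn_integral_one_minus_gamma_laplace_path_loss[OF mI alpha u v]) (simp add: C_eq ennreal_mult')
  have int: "integrable lborel (\<lambda>x. 1 - ?L x)"
    using L nn by (intro integrableI_nonneg) auto
  have val: "(\<integral>x. 1 - ?L x \<partial>lborel) = pi * Gamma (1 - 2/\<alpha>) * C"
    using L nn C alpha by (subst integral_eq_nn_integral) auto
  have "ennreal (expectation (\<lambda>\<omega>. ?F (fading \<omega>, locations \<omega>))) = (\<integral>\<^sup>+\<omega>. ennreal (?F (fading \<omega>, locations \<omega>)) \<partial>M)"
    by (rule nn_integral_eq_integral[symmetric]) (auto intro!: integrable_const_bound[where B = 1] simp: exp_neg_nonneg exp_neg_le_1)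
  also have "\<dots> = (\<integral>\<^sup>+\<omega>. (\<integral>\<^sup>+\<omega>'. ennreal (?F (fading \<omega>', locations \<omega>)) \<partial>M) \<partial>M)"
    by (rule nn_integral_indep_rv[OF indep_fading_locations, where F = "\<lambda>p. ennreal (?F p)"]) measurable
  also have "\<dots> = (\<integral>\<^sup>+\<omega>. ennreal (exp_neg (\<Sum>i. ennreal (- ln (?L (X i \<omega>))))) \<partial>M)"
  proof (rule nn_integral_cong)
    fix \<omega> assume "\<omega> \<in> space M"
    have [measurable]: "(\<lambda>\<omega>'. ?F (fading \<omega>', locations \<omega>)) \<in> borel_measurable M"
      by measurable (auto simp: space_PiM)
    have "(\<integral>\<^sup>+\<omega>'. ennreal (?F (fading \<omega>', locations \<omega>)) \<partial>M) = ennreal (expectation (\<lambda>\<omega>'. ?F (fading \<omega>', locations \<omega>)))"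
      by (rule nn_integral_eq_integral) (auto intro!: integrable_const_bound[where B = 1] simp: exp_neg_nonneg exp_neg_le_1)
    then show "(\<integral>\<^sup>+\<omega>'. ennreal (?F (fading \<omega>', locations \<omega>)) \<partial>M) = ennreal (exp_neg (\<Sum>i. ennreal (- ln (?L (X i \<omega>)))))"
      by (simp add: expectation_exp_shot_noise_given_locations[OF u v]) (simp add: locations_def)
  qed
  also have "\<dots> = ennreal (expectation (\<lambda>\<omega>. exp_neg (\<Sum>i. ennreal (- ln (?L (X i \<omega>))))))"
    by (rule nn_integral_eq_integral) (auto intro!: integrable_const_bound[where B = 1] simp: exp_neg_nonneg exp_neg_le_1)
  \<comment> \<open>With f = - ln L, the integrand 1 - exp (- f) of the Laplace functional is 1 - L,
    whose integral over the plane is already known.\<close>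
  also have "expectation (\<lambda>\<omega>. exp_neg (\<Sum>i. ennreal (- ln (?L (X i \<omega>))))) = exp (- (lam * (\<integral>x. 1 - exp (- (- ln (?L x))) \<partial>lborel)))"
    using L int lam by (intro PPP_Laplace_functional[OF PPP]) auto
  also have "(\<integral>x. 1 - exp (- (- ln (?L x))) \<partial>lborel) = pi * Gamma (1 - 2/\<alpha>) * C"
    using L by (simp add: val)
  finally show ?thesis by (subst (asm) ennreal_inj) (auto intro!: integral_nonneg simp: exp_neg_nonneg)
qed

end

section \<open>Derivatives of Laplace transforms and Erlang tails\<close>

text \<open>As u grows, E exp (- u S) isolates the event S = 0, and as u tends to 0 it isolates S <
  \<infinity>. The transform exp (- \<kappa> u powr q) of stable type tends to 0 and 1 respectively;
  u = n and u = 1/n give the two estimates.\<close>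

lemma (in prob_space) AE_pos_finite_if_stable_Laplace:
  fixes S :: "'a \<Rightarrow> ennreal"
  assumes S [measurable]: "S \<in> borel_measurable M" and \<kappa>: "\<kappa> > 0" and q: "q > 0"
    and L: "\<And>u. u > 0 \<Longrightarrow> expectation (\<lambda>\<omega>. exp_neg (ennreal u * S \<omega>)) = exp (- (\<kappa> * u powr q))"
  shows "AE \<omega> in M. 0 < S \<omega> \<and> S \<omega> < \<top>"
proof -
  have int: "integrable M (\<lambda>\<omega>. exp_neg (ennreal u * S \<omega>))" for u
    by (rule integrable_const_bound[where B = 1]) (auto simp: exp_neg_nonneg exp_neg_le_1)
  have 0: "prob {\<omega> \<in> space M. S \<omega> = 0} \<le> exp (- (\<kappa> * real n powr q))" if "n > 0" for n :: nat
  proof -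
    have "prob {\<omega> \<in> space M. S \<omega> = 0} = expectation (indicator {\<omega> \<in> space M. S \<omega> = 0})" by simp
    also have "\<dots> \<le> expectation (\<lambda>\<omega>. exp_neg (ennreal (real n) * S \<omega>))"
    proof (intro integral_mono int)
      show "indicat_real {\<omega> \<in> space M. S \<omega> = 0} \<omega> \<le> exp_neg (ennreal (real n) * S \<omega>)" for \<omega>
        by (cases "S \<omega> = 0") (auto simp: exp_neg_nonneg indicator_def, simp add: exp_neg_def)
    qed (simp add: less_top[symmetric])
    finally show ?thesis using that by (simp add: L)
  qed
  have "(\<lambda>n. exp (- (\<kappa> * real n powr q))) \<longlonglongrightarrow> 0"
    using \<kappa> q by real_asymp
  then have "prob {\<omega> \<in> space M. S \<omega> = 0} \<le> 0"
    by (rule LIMSEQ_le_const) (use 0 in \<open>auto intro!: exI[of _ 1]\<close>)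
  then have "prob {\<omega> \<in> space M. S \<omega> = 0} = 0" by (simp add: measure_le_0_iff)
  then have AE1: "AE \<omega> in M. S \<omega> \<noteq> 0"
    by (subst (asm) prob_eq_0) auto
  have 1: "prob {\<omega> \<in> space M. S \<omega> \<noteq> \<top>} \<ge> exp (- (\<kappa> * (1 / real n) powr q))" if "n > 0" for n :: nat
  proof -
    have "exp (- (\<kappa> * (1 / real n) powr q)) = expectation (\<lambda>\<omega>. exp_neg (ennreal (1 / real n) * S \<omega>))"
      using that by (simp add: L)
    also have "\<dots> \<le> expectation (indicator {\<omega> \<in> space M. S \<omega> \<noteq> \<top>})"
    proof (intro integral_mono int)
      show "exp_neg (ennreal (1 / real n) * S \<omega>) \<le> indicat_real {\<omega> \<in> space M. S \<omega> \<noteq> \<top>} \<omega>" if "\<omega> \<in> space M" for \<omega>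
        using that \<open>n > 0\<close> by (cases "S \<omega> = \<top>") (auto simp: exp_neg_le_1 indicator_def, simp add: exp_neg_def ennreal_mult_top)
    qed (simp add: less_top[symmetric])
    finally show ?thesis by simp
  qed
  have "(\<lambda>n. exp (- (\<kappa> * (1 / real n) powr q))) \<longlonglongrightarrow> 1"
    using \<kappa> q by real_asymp
  then have "prob {\<omega> \<in> space M. S \<omega> \<noteq> \<top>} \<ge> 1"
    by (rule LIMSEQ_le_const2) (use 1 in \<open>auto intro!: exI[of _ 1]\<close>)
  then have "prob {\<omega> \<in> space M. S \<omega> \<noteq> \<top>} = 1" using prob_le_1 by (intro antisym) auto
  then have AE2: "AE \<omega> in M. S \<omega> \<noteq> \<top>"
    by (subst (asm) prob_eq_1) (auto elim!: eventually_mono)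
  from AE1 AE2 show ?thesis
    by eventually_elim (auto simp: less_top zero_less_iff_neq_zero)
qed

text \<open>No moment of B is assumed: a part of the exponential absorbs the factor B. For s \<ge>
  t/2 the exponential is at most the square of exp (- (t/4) B); one copy bounds B by 4/t, the other
  is integrable against W by hypothesis at t/4.\<close>

lemma has_derivative_Laplace_transform:
  fixes W B :: "'a \<Rightarrow> real"
  assumes B: "B \<in> borel_measurable M" "\<And>x. x \<in> space M \<Longrightarrow> B x \<ge> 0"
    and int: "\<And>t. t > 0 \<Longrightarrow> integrable M (\<lambda>x. W x * exp (- (t * B x)))" and t: "t > 0"
  shows "integrable M (\<lambda>x. B x * W x * exp (- (t * B x)))"
    and "((\<lambda>t. \<integral>x. W x * exp (- (t * B x)) \<partial>M) has_field_derivative - (\<integral>x. B x * W x * exp (- (t * B x)) \<partial>M)) (at t)"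
proof -
  let ?w = "\<lambda>x. 4 / t * \<bar>W x * exp (- (t / 4 * B x))\<bar>"
  have w: "integrable M ?w" using t by (intro integrable_mult_right integrable_abs int) auto
  have bound: "\<bar>B x * W x * exp (- (s * B x))\<bar> \<le> ?w x" if "s \<ge> t / 2" "x \<in> space M" for s x
  proof -
    have Bx: "B x \<ge> 0" using that B by auto
    \<comment> \<open>The inequality x exp (- x) \<le> 1 at x = (t/4) B.\<close>
    have "t / 4 * B x * exp (- (t / 4 * B x)) \<le> 1"
      using exp_ge_add_one_self[of "t / 4 * B x"] by (simp add: exp_minus field_simps)
    then have 1: "B x * exp (- (t / 4 * B x)) \<le> 4 / t" using t by (simp add: field_simps)
    have "exp (- (s * B x)) \<le> exp (- (t / 2 * B x))" using mult_right_mono[OF that(1) Bx] by simp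
    also have "\<dots> = exp (- (t / 4 * B x)) * exp (- (t / 4 * B x))" by (simp add: exp_add[symmetric])
    finally have "B x * exp (- (s * B x)) \<le> B x * exp (- (t / 4 * B x)) * exp (- (t / 4 * B x))"
      using Bx by (simp add: mult_left_mono mult.assoc)
    also have "\<dots> \<le> 4 / t * exp (- (t / 4 * B x))" using 1 by (intro mult_right_mono) auto
    finally have "\<bar>W x\<bar> * (B x * exp (- (s * B x))) \<le> \<bar>W x\<bar> * (4 / t * exp (- (t / 4 * B x)))"
      by (intro mult_left_mono) auto
    then show ?thesis using Bx by (simp add: abs_mult mult_ac)
  qed
  have "(\<lambda>x. B x * (W x * exp (- (t * B x)))) \<in> borel_measurable M"
    by (rule borel_measurable_times[OF B(1) borel_measurable_integrable[OF int[OF t]]])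
  then have meas: "(\<lambda>x. B x * W x * exp (- (t * B x))) \<in> borel_measurable M" by (simp add: mult.assoc)
  show "integrable M (\<lambda>x. B x * W x * exp (- (t * B x)))"
    by (rule Bochner_Integration.integrable_bound[OF w meas])
       (intro AE_I2, use bound[of t] t in force)
  have "((\<lambda>t. \<integral>x. W x * exp (- (t * B x)) \<partial>M) has_field_derivative (\<integral>x. - (B x * W x * exp (- (t * B x))) \<partial>M)) (at t)"
  proof (rule has_field_derivative_integral_dominated[where r = "t / 2" and w = ?w])
    show "((\<lambda>z. W x * exp (- (z * B x))) has_field_derivative - (B x * W x * exp (- (s * B x)))) (at s)" for s x
      by (auto intro!: derivative_eq_intros)
    show "norm (- (B x * W x * exp (- (s * B x)))) \<le> ?w x" if "s \<in> ball t (t / 2)" "x \<in> space M" for s x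
      using that bound[of s x] by (auto simp: dist_real_def abs_real_def split: if_splits)
    show "(\<lambda>x. - (B x * W x * exp (- (t * B x)))) \<in> borel_measurable M" using meas by simp
  qed (use t w in \<open>auto intro!: int simp: dist_real_def abs_real_def split: if_splits\<close>)
  then show "((\<lambda>t. \<integral>x. W x * exp (- (t * B x)) \<partial>M) has_field_derivative - (\<integral>x. B x * W x * exp (- (t * B x)) \<partial>M)) (at t)"
    by simp
qed

text \<open>Each derivative moves one more factor - B into the weight, so the induction reuses the
  first-order lemma with weight B^j W and must carry integrability for all t > 0 along.\<close>

lemma higher_deriv_Laplace_transform:
  fixes W B :: "'a \<Rightarrow> real" and f :: "real \<Rightarrow> real"
  assumes B: "B \<in> borel_measurable M" "\<And>x. x \<in> space M \<Longrightarrow> B x \<ge> 0"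
    and int: "\<And>t. t > 0 \<Longrightarrow> integrable M (\<lambda>x. W x * exp (- (t * B x)))"
    and f: "\<And>t. t > 0 \<Longrightarrow> f t = (\<integral>x. W x * exp (- (t * B x)) \<partial>M)" and t: "t > 0"
  shows "integrable M (\<lambda>x. B x ^ j * W x * exp (- (t * B x))) \<and>
    (deriv ^^ j) f t = (-1) ^ j * (\<integral>x. B x ^ j * W x * exp (- (t * B x)) \<partial>M)"
  using t
proof (induction j arbitrary: t)
  case 0
  then show ?case using int f by simp
next
  case (Suc j)
  let ?W = "\<lambda>x. B x ^ j * W x"
  have D: "integrable M (\<lambda>x. B x * ?W x * exp (- (t * B x)))"
    "((\<lambda>t. \<integral>x. ?W x * exp (- (t * B x)) \<partial>M) has_field_derivative - (\<integral>x. B x * ?W x * exp (- (t * B x)) \<partial>M)) (at t)"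
    using B Suc by (auto intro!: has_derivative_Laplace_transform[where W = ?W])
  have "((\<lambda>t. (-1) ^ j * (\<integral>x. ?W x * exp (- (t * B x)) \<partial>M)) has_field_derivative
      (-1) ^ j * - (\<integral>x. B x * ?W x * exp (- (t * B x)) \<partial>M)) (at t)"
    by (intro DERIV_cmult D(2))
  \<comment> \<open>The formula for the j-th derivative is known on the open half-line only, which
    suffices since \<open>deriv\<close> depends on values near t.\<close>
  then have "((deriv ^^ j) f has_field_derivative (-1) ^ j * - (\<integral>x. B x * ?W x * exp (- (t * B x)) \<partial>M)) (at t)"
    by (rule has_field_derivative_transform_within_open[where S = "{0<..}"]) (use Suc in auto)
  then have "(deriv ^^ Suc j) f t = (-1) ^ j * - (\<integral>x. B x * ?W x * exp (- (t * B x)) \<partial>M)"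
    by (simp add: DERIV_imp_deriv)
  then show ?case using D(1) by (simp add: mult.assoc)
qed

text \<open>For an integer shape the Gamma law is an Erlang law, whose tail is a finite Poisson sum.
  This is where integrality of \<open>mD\<close> yields the sum over k.\<close>

lemma nn_integral_gamma_density_tail:
  assumes m: "m \<ge> 1"
  shows "(\<integral>\<^sup>+a. ennreal (gamma_density (real m) a) * indicator {c..} a \<partial>lborel) =
    (\<Sum>k<m. ennreal ((real m * max 0 c) ^ k / fact k * exp (- (real m * max 0 c))))"
proof -
  obtain n where n: "m = Suc n" using m by (cases m) auto
  let ?E = "erlang_density n (real m)"
  \<comment> \<open>For shape 1 the two densities differ at 0, where \<open>0 powr 0\<close> is 0
    but \<open>0 ^ 0\<close> is 1.\<close>
  have AE1: "AE a in lborel. gamma_density (real m) a = ?E a"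
  proof (rule eventually_mono[OF AE_lborel_singleton[of 0]])
    fix a :: real assume "a \<noteq> 0"
    show "gamma_density (real m) a = ?E a"
    proof (cases "a > 0")
      case True
      have "Gamma (real m) = fact n" using Gamma_fact[of n, where 'a = real] by (simp add: n add.commute)
      moreover have "a powr (real m - 1) = a ^ n" using True by (simp add: n powr_realpow)
      moreover have "real m powr real m = real m ^ Suc n" using m by (simp only: n powr_realpow)
      ultimately show ?thesis using True by (simp add: gamma_density_def erlang_density_def)
    qed (use \<open>a \<noteq> 0\<close> in \<open>auto simp: gamma_density_def erlang_density_def\<close>)
  qed
  \<comment> \<open>A negative threshold means the full mass: at c' = 0 only the term k = 0
    survives, with value 1.\<close>
  define c' where "c' = max 0 c"
  have E_le: "(\<integral>\<^sup>+a. ennreal (?E a) * indicator {..c'} a \<partial>lborel) = ennreal (erlang_CDF n (real m) c')"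
    using m by (intro nn_integral_erlang_density) auto
  have tot: "(\<integral>\<^sup>+a. ennreal (?E a) \<partial>lborel) = 1"
    using m nn_integral_erlang_ith_moment[of "real m" n 0] by simp
  have "(\<integral>\<^sup>+a. ennreal (gamma_density (real m) a) * indicator {c..} a \<partial>lborel) =
     (\<integral>\<^sup>+a. ennreal (?E a) - ennreal (?E a) * indicator {..c'} a \<partial>lborel)"
    by (intro nn_integral_cong_AE, use AE1 AE_lborel_singleton[of c'] AE_lborel_singleton[of 0] in eventually_elim)
       (auto simp: c'_def erlang_density_def max_def split: split_indicator if_splits)
  also have "\<dots> = (\<integral>\<^sup>+a. ennreal (?E a) \<partial>lborel) - (\<integral>\<^sup>+a. ennreal (?E a) * indicator {..c'} a \<partial>lborel)"
    by (rule nn_integral_diff) (auto simp: E_le split: split_indicator)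
  also have "\<dots> = ennreal (1 - erlang_CDF n (real m) c')"
    using m by (simp add: tot E_le ennreal_1[symmetric] ennreal_minus del: ennreal_1)
  also have "1 - erlang_CDF n (real m) c' = (\<Sum>k<m. (real m * c') ^ k / fact k * exp (- (real m * c')))"
  proof -
    have "{..<m} = {..n}" by (auto simp: n)
    then show ?thesis by (simp add: erlang_CDF_def c'_def)
  qed
  also have "ennreal \<dots> = (\<Sum>k<m. ennreal ((real m * c') ^ k / fact k * exp (- (real m * c'))))"
    by (intro sum_ennreal[symmetric]) (simp add: c'_def)
  finally show ?thesis unfolding c'_def .
qed

text \<open>The substitution b = I2 z turns the event into a \<ge> I1 (T - z). Its Jacobian I2
  raises the power m - 1 of the density to m at the price of 1/z: this is the origin of the 1/z in
  the formula and of the order m of the t-derivative.\<close>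

lemma nn_integral_gamma_density_MRC:
  assumes m: "m \<ge> 1" and I: "I1 > 0" "I2 > 0"
  shows "(\<integral>\<^sup>+b. ennreal (gamma_density (real m) b) *
      (\<integral>\<^sup>+a. ennreal (gamma_density (real m) a) * indicator {a. T \<le> a / I1 + b / I2} a \<partial>lborel) \<partial>lborel) =
    (\<integral>\<^sup>+z. indicator {0<..} z * (\<Sum>k<m. ennreal (1 / (z * Gamma (real m) * fact k) *
       ((real m * max 0 (T - z) * I1) ^ k * (real m * z * I2) ^ m *
         exp (- (real m * max 0 (T - z) * I1) - real m * z * I2)))) \<partial>lborel)"
proof -
  let ?S = "\<lambda>c. \<Sum>k<m. ennreal ((real m * max 0 c) ^ k / fact k * exp (- (real m * max 0 c)))"
  have inner: "(\<integral>\<^sup>+a. ennreal (gamma_density (real m) a) * indicator {a. T \<le> a / I1 + b / I2} a \<partial>lborel) = ?S (I1 * (T - b / I2))" for b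
  proof -
    have "{a. T \<le> a / I1 + b / I2} = {I1 * (T - b / I2)..}" using I by (auto simp: field_simps)
    then show ?thesis by (simp only: nn_integral_gamma_density_tail[OF m])
  qed
  have "(\<integral>\<^sup>+b. ennreal (gamma_density (real m) b) * ?S (I1 * (T - b / I2)) \<partial>lborel) =
     ennreal \<bar>I2\<bar> * (\<integral>\<^sup>+z. ennreal (gamma_density (real m) (0 + I2 * z)) * ?S (I1 * (T - (0 + I2 * z) / I2)) \<partial>lborel)"
    using I by (intro nn_integral_real_affine) auto
  also have "\<dots> = (\<integral>\<^sup>+z. ennreal I2 * (ennreal (gamma_density (real m) (I2 * z)) * ?S (I1 * (T - z))) \<partial>lborel)"
    using I by (subst nn_integral_cmult[symmetric]) auto
  also have "\<dots> = (\<integral>\<^sup>+z. indicator {0<..} z * (\<Sum>k<m. ennreal (1 / (z * Gamma (real m) * fact k) *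
       ((real m * max 0 (T - z) * I1) ^ k * (real m * z * I2) ^ m *
         exp (- (real m * max 0 (T - z) * I1) - real m * z * I2)))) \<partial>lborel)"
  proof (intro nn_integral_cong_AE eventually_mono[OF AE_lborel_singleton[of 0]])
    fix z :: real assume "z \<noteq> 0"
    show "ennreal I2 * (ennreal (gamma_density (real m) (I2 * z)) * ?S (I1 * (T - z))) =
      indicator {0<..} z * (\<Sum>k<m. ennreal (1 / (z * Gamma (real m) * fact k) *
       ((real m * max 0 (T - z) * I1) ^ k * (real m * z * I2) ^ m *
         exp (- (real m * max 0 (T - z) * I1) - real m * z * I2))))"
    proof (cases "z > 0")
      case z: True
      have mx: "max 0 (I1 * (T - z)) = max 0 (T - z) * I1" using I by (auto simp: max_def zero_le_mult_iff mult.commute)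
      have p: "I2 * (real m powr real m * (I2 * z) powr (real m - 1)) = (real m * z * I2) ^ m / z"
        using m z I by (simp add: powr_diff powr_realpow power_mult_distrib field_simps)
      have "I2 * gamma_density (real m) (I2 * z) * ((real m * (max 0 (T - z) * I1)) ^ k / fact k * exp (- (real m * (max 0 (T - z) * I1)))) =
         1 / (z * Gamma (real m) * fact k) * ((real m * max 0 (T - z) * I1) ^ k * (real m * z * I2) ^ m *
         exp (- (real m * max 0 (T - z) * I1) - real m * z * I2))" for k
      proof -
        have "I2 * gamma_density (real m) (I2 * z) = (real m * z * I2) ^ m / z / Gamma (real m) * exp (- (real m * z * I2))"
          unfolding p[symmetric] using z I by (simp add: gamma_density_def mult_ac)
        then show ?thesis by (simp add: exp_diff exp_minus field_simps mult.assoc)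
      qed
      then show ?thesis using z I m gamma_density_nonneg[of "real m" "I2 * z"]
        unfolding mx by (simp add: sum_distrib_left ennreal_mult'[symmetric] mult.assoc)
    next
      case False
      with \<open>z \<noteq> 0\<close> I have "I2 * z < 0" by (simp add: mult_less_0_iff)
      then show ?thesis using False by (simp add: gamma_density_def)
    qed
  qed
  finally show ?thesis unfolding inner .
qed

section \<open>The success probability\<close>

text \<open>Visible in Euler's integral, where prefactor and integrand are nonnegative. It supplies
  the sign condition on C in \<open>shot_noise_Laplace_transform\<close>.\<close>

lemma hyp2F1_reg_nonneg:
  assumes "0 < b" "b < c" "x < 1"
  shows "hyp2F1_reg a b c x \<ge> 0"
  unfolding hyp2F1_reg_def hyp2F1_Euler_integral[OF assms]
  using assms by (intro divide_nonneg_nonneg mult_nonneg_nonneg integral_nonneg) (auto intro!: less_imp_le[OF Gamma_real_pos])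

text \<open>The coefficient 0 is kept in the integrand so that the statements match
  \<open>C_eq\<close> of \<open>shot_noise_Laplace_transform\<close> at u = 0 and at v = 0. The
  density of the absent variable integrates to 1.\<close>

lemma nn_integral_gamma_density_powr_marginal:
  assumes m: "m > 0" and q: "q \<ge> 0" and w: "w \<ge> 0"
  defines "C \<equiv> w powr q * (Gamma (m + q) / (m powr q * Gamma m))"
  shows "(\<integral>\<^sup>+a. (\<integral>\<^sup>+b. ennreal (gamma_density m a * gamma_density m b * (0 * a + w * b) powr q) \<partial>lborel) \<partial>lborel) = ennreal C"
    and "(\<integral>\<^sup>+a. (\<integral>\<^sup>+b. ennreal (gamma_density m a * gamma_density m b * (w * a + 0 * b) powr q) \<partial>lborel) \<partial>lborel) = ennreal C"
proof -
  let ?g = "gamma_density m"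
  have G: "?g y \<ge> 0" for y by (rule gamma_density_nonneg[OF m])
  have powr: "?g y * (w * y) powr q = w powr q * (?g y * y powr q)" for y
    using w by (cases "y \<ge> 0") (auto simp: powr_mult gamma_density_def)
  have C: "(\<integral>\<^sup>+y. ennreal (?g y * (w * y) powr q) \<partial>lborel) = ennreal C"
    unfolding powr C_def
    using w m q by (subst ennreal_mult'[OF powr_ge_zero], subst nn_integral_cmult)
      (simp_all add: nn_integral_gamma_density_powr ennreal_mult'[symmetric])
  have "(\<integral>\<^sup>+b. ennreal (?g a * ?g b * (0 * a + w * b) powr q) \<partial>lborel) = ennreal (?g a) * ennreal C" for a
    unfolding C[symmetric] using G by (subst nn_integral_cmult[symmetric]) (simp_all add: ennreal_mult'[symmetric] mult.assoc)
  then show "(\<integral>\<^sup>+a. (\<integral>\<^sup>+b. ennreal (?g a * ?g b * (0 * a + w * b) powr q) \<partial>lborel) \<partial>lborel) = ennreal C"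
    using m by (simp only:, subst nn_integral_multc) (simp_all add: nn_integral_gamma_density)
  have "(\<integral>\<^sup>+b. ennreal (?g a * ?g b * (w * a + 0 * b) powr q) \<partial>lborel) = ennreal (?g a * (w * a) powr q) * (\<integral>\<^sup>+b. ennreal (?g b) \<partial>lborel)" for a
    using G by (subst nn_integral_cmult[symmetric]) (simp_all add: ennreal_mult'[symmetric] mult_ac)
  then show "(\<integral>\<^sup>+a. (\<integral>\<^sup>+b. ennreal (?g a * ?g b * (w * a + 0 * b) powr q) \<partial>lborel) \<partial>lborel) = ennreal C"
    using m by (simp add: nn_integral_gamma_density C)
qed

section \<open>Interference, desired gains and the kernel as an expectation\<close>

context mrc_model
begin

abbreviation S :: "nat \<Rightarrow> 'a \<Rightarrow> ennreal" where
  "S n \<omega> \<equiv> shot_noise n (fading \<omega>, locations \<omega>)"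

lemma S_measurable [measurable]: "n \<in> {1,2} \<Longrightarrow> S n \<in> borel_measurable M"
  by (rule measurable_compose[OF _ shot_noise_measurable]) auto

text \<open>Finiteness makes the real series converge; positivity keeps the denominators of the SINR
  nonzero even without noise.\<close>

lemma AE_shot_noise: "AE \<omega> in M. \<forall>n\<in>{1,2}. 0 < S n \<omega> \<and> S n \<omega> < \<top>"
proof -
  let ?c = "Gamma (mI + 2/\<alpha>) / (mI powr (2/\<alpha>) * Gamma mI)"
  let ?k = "lam * (pi * Gamma (1 - 2/\<alpha>) * ?c)"
  have c: "?c > 0" using mI alpha by (intro divide_pos_pos mult_pos_pos Gamma_real_pos add_pos_pos) auto
  then have k: "?k > 0" using lam alpha by (intro mult_pos_pos Gamma_real_pos) auto
  have C: "u powr (2/\<alpha>) * ?c \<ge> 0" if "u > 0" for u using c by (intro mult_nonneg_nonneg) auto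
  have "AE \<omega> in M. 0 < S 1 \<omega> \<and> S 1 \<omega> < \<top>"
  proof (rule AE_pos_finite_if_stable_Laplace[OF S_measurable k])
    fix u :: real assume u: "u > 0"
    show "expectation (\<lambda>\<omega>. exp_neg (ennreal u * S 1 \<omega>)) = exp (- (?k * u powr (2/\<alpha>)))"
      using shot_noise_Laplace_transform[of u 0, OF _ _ C[OF u] nn_integral_gamma_density_powr_marginal(2)[OF mI]] u alpha
      by (simp add: mult_ac)
  qed (use alpha in auto)
  moreover have "AE \<omega> in M. 0 < S 2 \<omega> \<and> S 2 \<omega> < \<top>"
  proof (rule AE_pos_finite_if_stable_Laplace[OF S_measurable k])
    fix u :: real assume u: "u > 0"
    show "expectation (\<lambda>\<omega>. exp_neg (ennreal u * S 2 \<omega>)) = exp (- (?k * u powr (2/\<alpha>)))"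
      using shot_noise_Laplace_transform[of 0 u, OF _ _ C[OF u] nn_integral_gamma_density_powr_marginal(1)[OF mI]] u alpha
      by (simp add: mult_ac)
  qed (use alpha in auto)
  ultimately show ?thesis by eventually_elim auto
qed

text \<open>The real infinite sum carries information only if it converges. Where the extended sum
  is finite the nonnegative terms are summable and both sums agree; elsewhere, on a null set,
  nothing is claimed.\<close>

lemma AE_interference_eq:
  "AE \<omega> in M. \<forall>n\<in>{1,2}. interference \<alpha> d h X n \<omega> = d powr \<alpha> * enn2real (S n \<omega>)"
  using AE_shot_noise AE_h_nonneg
proof eventually_elim
  fix \<omega> assume 1: "\<forall>n\<in>{1,2}. 0 < S n \<omega> \<and> S n \<omega> < \<top>" and 2: "\<forall>n\<in>{1,2}. \<forall>i. h n i \<omega> \<ge> 0"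
  show "\<forall>n\<in>{1,2}. interference \<alpha> d h X n \<omega> = d powr \<alpha> * enn2real (S n \<omega>)"
  proof
    fix n :: nat assume n: "n \<in> {1,2}"
    let ?f = "\<lambda>i. h n i \<omega> * norm (X i \<omega>) powr (- \<alpha>)"
    have f: "?f i \<ge> 0" for i using 2 n by auto
    have S: "S n \<omega> = (\<Sum>i. ennreal (?f i))"
      using n by (auto simp: shot_noise_def fading_def locations_def mark_def)
    have "(\<Sum>i. ennreal (?f i)) \<noteq> \<top>" using 1 n unfolding S[symmetric] by auto
    then have "summable ?f" using f by (intro summable_suminf_not_top) auto
    then have "S n \<omega> = ennreal (\<Sum>i. ?f i)" unfolding S using f by (intro suminf_ennreal2) auto
    moreover have "(\<Sum>i. ?f i) \<ge> 0" using \<open>summable ?f\<close> f by (intro suminf_nonneg)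
    ultimately show "interference \<alpha> d h X n \<omega> = d powr \<alpha> * enn2real (S n \<omega>)"
      by (simp add: interference_def)
  qed
qed

lemma g_measurable [measurable]: "n \<in> {1,2} \<Longrightarrow> g n \<in> borel_measurable M"
  using distributed_measurable[OF g_distr] by simp

text \<open>Independence is used in three layers: all marks from the locations, the gains from the
  fading, and one gain from the other. This lets each gain be integrated against its density while
  the interference stays fixed.\<close>

lemma nn_integral_gains:
  assumes F [measurable]: "F \<in> borel_measurable ((borel \<Otimes>\<^sub>M borel) \<Otimes>\<^sub>M (Pi\<^sub>M fading_index (\<lambda>_. borel) \<Otimes>\<^sub>M Pi\<^sub>M UNIV (\<lambda>_. borel)))"
  shows "(\<integral>\<^sup>+\<omega>. F ((g 1 \<omega>, g 2 \<omega>), (fading \<omega>, locations \<omega>)) \<partial>M) =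
    (\<integral>\<^sup>+\<omega>. (\<integral>\<^sup>+b. ennreal (gamma_density (real mD) b) *
       (\<integral>\<^sup>+a. ennreal (gamma_density (real mD) a) * F ((a, b), (fading \<omega>, locations \<omega>)) \<partial>lborel) \<partial>lborel) \<partial>M)"
proof -
  let ?H = "Pi\<^sub>M fading_index (\<lambda>_. borel) :: (nat + nat \<times> nat \<Rightarrow> real) measure"
  let ?X = "Pi\<^sub>M UNIV (\<lambda>_. borel) :: (nat \<Rightarrow> real^2) measure"
  have comp: "(\<lambda>m. m j) \<in> borel_measurable (Pi\<^sub>M A (\<lambda>_. borel))" if "j \<in> A" for j :: "nat + nat \<times> nat" and A
    using that by (rule measurable_component_singleton)
  have R1: "indep_rv ((borel \<Otimes>\<^sub>M borel) \<Otimes>\<^sub>M ?H) (\<lambda>\<omega>. ((g 1 \<omega>, g 2 \<omega>), fading \<omega>)) ?X locations"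
  proof -
    have "indep_rv ((borel \<Otimes>\<^sub>M borel) \<Otimes>\<^sub>M ?H)
       (\<lambda>\<omega>. (\<lambda>m. ((m (Inl 1), m (Inl 2)), restrict m fading_index)) (\<lambda>j\<in>mark_index. mark j \<omega>)) ?X (\<lambda>\<omega>. (\<lambda>x. x) (locations \<omega>))"
    proof (rule indep_rv_compose[OF indep_marks_locations])
      show "(\<lambda>m. ((m (Inl 1), m (Inl 2)), restrict m fading_index)) \<in> measurable (Pi\<^sub>M mark_index (\<lambda>_. borel)) ((borel \<Otimes>\<^sub>M borel) \<Otimes>\<^sub>M ?H)"
        by (intro measurable_Pair comp measurable_restrict_subset) auto
    qed simp
    moreover have "restrict (\<lambda>j\<in>mark_index. mark j \<omega>) fading_index = fading \<omega>" for \<omega>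
      by (auto simp: fun_eq_iff fading_def)
    ultimately show ?thesis by (simp add: mark_def)
  qed
  have R2: "indep_rv (borel \<Otimes>\<^sub>M borel) (\<lambda>\<omega>. (g 1 \<omega>, g 2 \<omega>)) ?H fading"
  proof -
    have "indep_rv (Pi\<^sub>M (Inl ` {1,2}) (\<lambda>_. borel)) (\<lambda>\<omega>. \<lambda>j\<in>Inl ` {1,2}. mark j \<omega>) ?H (\<lambda>\<omega>. \<lambda>j\<in>fading_index. mark j \<omega>)"
      by (intro indep_var_imp_indep_rv indep_var_restrict[OF indep_mark]) auto
    then have "indep_rv (borel \<Otimes>\<^sub>M borel) (\<lambda>\<omega>. (\<lambda>m. (m (Inl 1), m (Inl 2))) (\<lambda>j\<in>Inl ` {1,2}. mark j \<omega>)) ?H (\<lambda>\<omega>. (\<lambda>x. x) (\<lambda>j\<in>fading_index. mark j \<omega>))"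
    proof (rule indep_rv_compose)
      show "(\<lambda>m. (m (Inl 1), m (Inl 2))) \<in> measurable (Pi\<^sub>M (Inl ` {1,2}) (\<lambda>_. borel)) (borel \<Otimes>\<^sub>M borel)"
        by (intro measurable_Pair comp) auto
    qed simp
    then show ?thesis by (simp add: mark_def fading_def[abs_def])
  qed
  have R3: "indep_rv borel (g 1) borel (g 2)"
  proof -
    have "indep_rv (Pi\<^sub>M {Inl 1} (\<lambda>_. borel)) (\<lambda>\<omega>. \<lambda>j\<in>{Inl 1}. mark j \<omega>) (Pi\<^sub>M {Inl 2} (\<lambda>_. borel)) (\<lambda>\<omega>. \<lambda>j\<in>{Inl 2}. mark j \<omega>)"
      by (intro indep_var_imp_indep_rv indep_var_restrict[OF indep_mark]) auto
    then have "indep_rv borel (\<lambda>\<omega>. (\<lambda>m. m (Inl 1)) (\<lambda>j\<in>{Inl 1}. mark j \<omega>)) borel (\<lambda>\<omega>. (\<lambda>m. m (Inl 2)) (\<lambda>j\<in>{Inl 2}. mark j \<omega>))"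
      by (rule indep_rv_compose) (auto intro!: comp)
    then show ?thesis by (simp add: mark_def)
  qed
  let ?\<Phi> = "\<lambda>p. \<integral>\<^sup>+\<omega>. F ((g 1 \<omega>, g 2 \<omega>), p) \<partial>M"
  have G [measurable]: "(\<lambda>\<omega>. (g 1 \<omega>, g 2 \<omega>)) \<in> measurable M (borel \<Otimes>\<^sub>M borel)"
    by (intro measurable_Pair g_measurable) auto
  have \<Phi>: "?\<Phi> p = (\<integral>\<^sup>+b. ennreal (gamma_density (real mD) b) * (\<integral>\<^sup>+a. ennreal (gamma_density (real mD) a) * F ((a, b), p) \<partial>lborel) \<partial>lborel)"
    if p: "p \<in> space (?H \<Otimes>\<^sub>M ?X)" for p
  proof -
    have [measurable]: "(\<lambda>q. F (q, p)) \<in> borel_measurable (borel \<Otimes>\<^sub>M borel)"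
      using measurable_compose[OF measurable_Pair[OF measurable_ident measurable_const[OF p]] F] by simp
    have "?\<Phi> p = (\<integral>\<^sup>+\<omega>. (\<integral>\<^sup>+\<omega>'. F ((g 1 \<omega>', g 2 \<omega>), p) \<partial>M) \<partial>M)"
      by (rule nn_integral_indep_rv[OF R3, where F = "\<lambda>q. F (q, p)"]) simp
    also have "\<dots> = (\<integral>\<^sup>+\<omega>. (\<integral>\<^sup>+a. ennreal (gamma_density (real mD) a) * F ((a, g 2 \<omega>), p) \<partial>lborel) \<partial>M)"
      by (intro nn_integral_cong distributed_nn_integral[OF g_distr, symmetric]) auto
    also have "\<dots> = (\<integral>\<^sup>+b. ennreal (gamma_density (real mD) b) * (\<integral>\<^sup>+a. ennreal (gamma_density (real mD) a) * F ((a, b), p) \<partial>lborel) \<partial>lborel)"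
      by (rule distributed_nn_integral[OF g_distr, symmetric]) auto
    finally show ?thesis .
  qed
  have "(\<integral>\<^sup>+\<omega>. F ((g 1 \<omega>, g 2 \<omega>), (fading \<omega>, locations \<omega>)) \<partial>M) =
      (\<integral>\<^sup>+\<omega>. (\<integral>\<^sup>+\<omega>'. F ((g 1 \<omega>', g 2 \<omega>'), (fading \<omega>', locations \<omega>)) \<partial>M) \<partial>M)"
    using nn_integral_indep_rv[OF R1, of "\<lambda>q. F (fst (fst q), (snd (fst q), snd q))"] by simp
  also have "\<dots> = (\<integral>\<^sup>+\<omega>. (\<integral>\<^sup>+\<omega>'. ?\<Phi> (fading \<omega>', locations \<omega>) \<partial>M) \<partial>M)"
  proof (rule nn_integral_cong)
    fix \<omega> assume "\<omega> \<in> space M"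
    then have [measurable]: "locations \<omega> \<in> space ?X" using measurable_space[OF locations_measurable] by auto
    have "(\<lambda>q. F (fst q, (snd q, locations \<omega>))) \<in> borel_measurable ((borel \<Otimes>\<^sub>M borel) \<Otimes>\<^sub>M ?H)"
      by measurable
    from nn_integral_indep_rv[OF R2 this]
    show "(\<integral>\<^sup>+\<omega>'. F ((g 1 \<omega>', g 2 \<omega>'), (fading \<omega>', locations \<omega>)) \<partial>M) = (\<integral>\<^sup>+\<omega>'. ?\<Phi> (fading \<omega>', locations \<omega>) \<partial>M)"
      by simp
  qed
  \<comment> \<open>With the gains gone, independence is read backwards to put fading and locations
    on one sample point again.\<close>
  also have "\<dots> = (\<integral>\<^sup>+\<omega>. ?\<Phi> (fading \<omega>, locations \<omega>) \<partial>M)"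
    by (rule nn_integral_indep_rv[OF indep_fading_locations, symmetric]) measurable
  also have "\<dots> = (\<integral>\<^sup>+\<omega>. (\<integral>\<^sup>+b. ennreal (gamma_density (real mD) b) *
       (\<integral>\<^sup>+a. ennreal (gamma_density (real mD) a) * F ((a, b), (fading \<omega>, locations \<omega>)) \<partial>lborel) \<partial>lborel) \<partial>M)"
    by (intro nn_integral_cong \<Phi>)
       (auto simp: space_pair_measure measurable_space[OF locations_measurable] measurable_space[OF fading_measurable])
  finally show ?thesis .
qed

text \<open>The noise contributes a deterministic exponential factor; the rest is the joint
  transform of the shot noises at u = s m (T - z)^+ d^\<alpha> and v = t m z d^\<alpha>. The two
  cases of \<open>A_fun\<close> are u > 0 and u = 0.\<close>

lemma MRC_kernel_eq_expectation:
  assumes d: "d > 0" and z: "z > 0" and s: "s > 0" and t: "t > 0"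
  shows "MRC_kernel lam \<alpha> d T mD mI snr z s t = expectation (\<lambda>\<omega>.
     exp (- (s * (real mD * max 0 (T - z) * (d powr \<alpha> * enn2real (S 1 \<omega>) + snr_inv snr)))) *
     exp (- (t * (real mD * z * (d powr \<alpha> * enn2real (S 2 \<omega>) + snr_inv snr)))))"
proof -
  let ?\<sigma> = "snr_inv snr" and ?q = "2/\<alpha>"
  define u where "u = s * real mD * max 0 (T - z) * d powr \<alpha>"
  define v where "v = t * real mD * z * d powr \<alpha>"
  have u0: "u \<ge> 0" using s by (simp add: u_def)
  have v0: "v > 0" using t z d mD by (simp add: v_def)
  have q0: "?q \<ge> 0" using alpha by simp
  \<comment> \<open>The moment has degree 2/\<alpha> in (u, v), so the distance enters the formula
    as d^2.\<close>
  have dq: "(d powr \<alpha>) powr ?q = d ^ 2"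
    using d alpha by (simp add: powr_powr)
  define E where "E = exp (- (max 0 (T - z)) * s * real mD * ?\<sigma> - z * t * real mD * ?\<sigma>)"
  have A_eq: "expectation (\<lambda>\<omega>. exp_neg (ennreal u * S 1 \<omega> + ennreal v * S 2 \<omega>)) = exp (- (pi * lam * A_fun \<alpha> d T mD mI z s t))"
  proof (cases "z < T")
    case True
    then have u: "u > 0" using s d mD by (simp add: u_def)
    let ?F = "hyp2F1_reg (- ?q) mI (2 * mI) (1 - v / u)"
    let ?C = "Gamma (?q + 2 * mI) / mI powr ?q * u powr ?q * ?F"
    have C: "?C \<ge> 0" using mI u v0 alpha
      by (intro mult_nonneg_nonneg divide_nonneg_nonneg hyp2F1_reg_nonneg less_imp_le[OF Gamma_real_pos] add_pos_pos) auto
    \<comment> \<open>The common factors m and d^\<alpha> cancel, which leaves the argument of the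
      hypergeometric function in \<open>A_fun\<close>.\<close>
    have vu: "v / u = z * t / ((T - z) * s)"
      using True d mD s by (simp add: u_def v_def mult.commute)
    have uq: "u powr ?q = s powr ?q * real mD powr ?q * (T - z) powr ?q * d ^ 2"
      using True s d by (simp add: u_def powr_mult flip: dq)
    have "A_fun \<alpha> d T mD mI z s t = Gamma (1 - ?q) * ?C"
      using True mI by (simp add: A_fun_def uq vu powr_divide mult_ac)
    then show ?thesis
      using shot_noise_Laplace_transform[OF u0 less_imp_le[OF v0] C nn_integral_gamma_density_combination[OF mI q0 u v0]]
      by (simp add: mult_ac)
  next
    case False
    \<comment> \<open>From z = T on the second branch alone reaches the threshold, so only the
      marginal transform of its interference remains.\<close>
    then have u: "u = 0" by (simp add: u_def)
    let ?C = "v powr ?q * (Gamma (mI + ?q) / (mI powr ?q * Gamma mI))"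
    have C: "?C \<ge> 0" using mI alpha
      by (intro mult_nonneg_nonneg divide_nonneg_nonneg less_imp_le[OF Gamma_real_pos] add_pos_pos) auto
    have vq: "v powr ?q = real mD powr ?q * (z * t) powr ?q * d ^ 2"
      using z t d by (simp add: v_def powr_mult flip: dq)
    have "A_fun \<alpha> d T mD mI z s t = Gamma (1 - ?q) * ?C"
      using False mI by (simp add: A_fun_def vq powr_divide mult_ac add.commute)
    then show ?thesis
      using shot_noise_Laplace_transform[of 0 v, OF _ less_imp_le[OF v0] C nn_integral_gamma_density_powr_marginal(1)[OF mI q0 less_imp_le[OF v0]]]
      unfolding u by (simp add: mult_ac)
  qed
  have "expectation (\<lambda>\<omega>.
     exp (- (s * (real mD * max 0 (T - z) * (d powr \<alpha> * enn2real (S 1 \<omega>) + ?\<sigma>)))) *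
     exp (- (t * (real mD * z * (d powr \<alpha> * enn2real (S 2 \<omega>) + ?\<sigma>))))) =
     expectation (\<lambda>\<omega>. E * exp_neg (ennreal u * S 1 \<omega> + ennreal v * S 2 \<omega>))"
  proof (rule integral_cong_AE)
    show "AE \<omega> in M. exp (- (s * (real mD * max 0 (T - z) * (d powr \<alpha> * enn2real (S 1 \<omega>) + ?\<sigma>)))) *
       exp (- (t * (real mD * z * (d powr \<alpha> * enn2real (S 2 \<omega>) + ?\<sigma>)))) = E * exp_neg (ennreal u * S 1 \<omega> + ennreal v * S 2 \<omega>)"
      using AE_shot_noise
    proof eventually_elim
      fix \<omega> assume "\<forall>n\<in>{1,2}. 0 < S n \<omega> \<and> S n \<omega> < \<top>"
      then have "ennreal (enn2real (S 1 \<omega>)) = S 1 \<omega>" "ennreal (enn2real (S 2 \<omega>)) = S 2 \<omega>" by auto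
      then have "ennreal u * S 1 \<omega> + ennreal v * S 2 \<omega> = ennreal (u * enn2real (S 1 \<omega>) + v * enn2real (S 2 \<omega>))"
        using u0 v0 by (simp add: ennreal_mult')
      then have "E * exp_neg (ennreal u * S 1 \<omega> + ennreal v * S 2 \<omega>) = E * exp (- (u * enn2real (S 1 \<omega>) + v * enn2real (S 2 \<omega>)))"
        using u0 v0 by (simp only:, subst exp_neg_ennreal) auto
      then show "exp (- (s * (real mD * max 0 (T - z) * (d powr \<alpha> * enn2real (S 1 \<omega>) + ?\<sigma>)))) *
       exp (- (t * (real mD * z * (d powr \<alpha> * enn2real (S 2 \<omega>) + ?\<sigma>)))) = E * exp_neg (ennreal u * S 1 \<omega> + ennreal v * S 2 \<omega>)"
        by (simp add: E_def u_def v_def exp_add[symmetric] algebra_simps)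
    qed
  qed measurable
  also have "\<dots> = E * exp (- (pi * lam * A_fun \<alpha> d T mD mI z s t))"
    by (simp add: A_eq)
  also have "\<dots> = MRC_kernel lam \<alpha> d T mD mI snr z s t"
    unfolding MRC_kernel_def E_def by (simp add: exp_add[symmetric] algebra_simps)
  finally show ?thesis ..
qed

end

context mrc_model
begin

text \<open>The lemma on Laplace transforms is applied twice: in t with weight exp (- s A), for
  every s > 0 because the outer derivative needs a function of s near 1, and then in s.\<close>

lemma higher_deriv_MRC_kernel:
  fixes d T z :: real and snr :: ereal and k :: nat
  assumes d: "d > 0" and z: "z > 0" and \<sigma>: "snr_inv snr \<ge> 0"
  defines "A \<equiv> \<lambda>\<omega>. real mD * max 0 (T - z) * (d powr \<alpha> * enn2real (S 1 \<omega>) + snr_inv snr)"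
    and "B \<equiv> \<lambda>\<omega>. real mD * z * (d powr \<alpha> * enn2real (S 2 \<omega>) + snr_inv snr)"
  shows "integrable M (\<lambda>\<omega>. A \<omega> ^ k * B \<omega> ^ mD * exp (- A \<omega> - B \<omega>))"
    and "(deriv ^^ k) (\<lambda>s. (deriv ^^ mD) (\<lambda>t. MRC_kernel lam \<alpha> d T mD mI snr z s t) 1) 1 =
      (-1) ^ (k + mD) * expectation (\<lambda>\<omega>. A \<omega> ^ k * B \<omega> ^ mD * exp (- A \<omega> - B \<omega>))"
proof -
  have [measurable]: "A \<in> borel_measurable M" "B \<in> borel_measurable M"
    unfolding A_def B_def by measurable
  have A0: "A \<omega> \<ge> 0" and B0: "B \<omega> \<ge> 0" for \<omega>
    using z \<sigma> by (auto simp: A_def B_def)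
  have inner: "integrable M (\<lambda>\<omega>. B \<omega> ^ mD * exp (- (s * A \<omega>)) * exp (- (1 * B \<omega>))) \<and>
      (deriv ^^ mD) (\<lambda>t. MRC_kernel lam \<alpha> d T mD mI snr z s t) 1 =
      (-1) ^ mD * expectation (\<lambda>\<omega>. B \<omega> ^ mD * exp (- (s * A \<omega>)) * exp (- (1 * B \<omega>)))" if s: "s > 0" for s
  proof (rule higher_deriv_Laplace_transform)
    show "integrable M (\<lambda>\<omega>. exp (- (s * A \<omega>)) * exp (- (t * B \<omega>)))" if "t > 0" for t
      using A0 B0 s that by (intro integrable_const_bound[where B = 1]) (auto intro!: mult_le_one)
    show "MRC_kernel lam \<alpha> d T mD mI snr z s t = expectation (\<lambda>\<omega>. exp (- (s * A \<omega>)) * exp (- (t * B \<omega>)))" if "t > 0" for t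
      unfolding A_def B_def by (rule MRC_kernel_eq_expectation[OF d z s that])
  qed (use B0 in auto)
  \<comment> \<open>The sign of the inner derivative is absorbed into the weight, so that the inner
    derivative itself is a Laplace transform in s.\<close>
  let ?W = "\<lambda>\<omega>. (-1) ^ mD * (B \<omega> ^ mD * exp (- B \<omega>))"
  have W: "?W \<omega> * exp (- (s * A \<omega>)) = (-1) ^ mD * (B \<omega> ^ mD * exp (- (s * A \<omega>)) * exp (- (1 * B \<omega>)))" for s \<omega>
    by simp
  have outer: "integrable M (\<lambda>\<omega>. A \<omega> ^ k * ?W \<omega> * exp (- (1 * A \<omega>))) \<and>
     (deriv ^^ k) (\<lambda>s. (deriv ^^ mD) (\<lambda>t. MRC_kernel lam \<alpha> d T mD mI snr z s t) 1) 1 =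
      (-1) ^ k * expectation (\<lambda>\<omega>. A \<omega> ^ k * ?W \<omega> * exp (- (1 * A \<omega>)))"
  proof (rule higher_deriv_Laplace_transform)
    show "integrable M (\<lambda>\<omega>. ?W \<omega> * exp (- (s * A \<omega>)))" if "s > 0" for s
      unfolding W using inner[OF that] by (intro integrable_mult_right) auto
    show "(deriv ^^ mD) (\<lambda>t. MRC_kernel lam \<alpha> d T mD mI snr z s t) 1 = expectation (\<lambda>\<omega>. ?W \<omega> * exp (- (s * A \<omega>)))" if "s > 0" for s
      unfolding W using inner[OF that] by simp
  qed (use A0 in auto)
  have eq: "A \<omega> ^ k * ?W \<omega> * exp (- (1 * A \<omega>)) = (-1) ^ mD * (A \<omega> ^ k * B \<omega> ^ mD * exp (- A \<omega> - B \<omega>))" for \<omega>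
    by (simp add: exp_diff exp_minus field_simps)
  have "integrable M (\<lambda>\<omega>. (-1) ^ mD * ((-1) ^ mD * (A \<omega> ^ k * B \<omega> ^ mD * exp (- A \<omega> - B \<omega>))))"
    using outer unfolding eq by (intro integrable_mult_right) auto
  then show "integrable M (\<lambda>\<omega>. A \<omega> ^ k * B \<omega> ^ mD * exp (- A \<omega> - B \<omega>))"
    by (simp add: mult.assoc[symmetric] power_mult_distrib[symmetric])
  show "(deriv ^^ k) (\<lambda>s. (deriv ^^ mD) (\<lambda>t. MRC_kernel lam \<alpha> d T mD mI snr z s t) 1) 1 =
      (-1) ^ (k + mD) * expectation (\<lambda>\<omega>. A \<omega> ^ k * B \<omega> ^ mD * exp (- A \<omega> - B \<omega>))"
    using outer unfolding eq by (simp add: power_add)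
qed

lemma success_probability:
  fixes d T :: real and snr :: ereal
  assumes d: "d > 0" and snr: "snr > 0"
  shows "prob {\<omega> \<in> space M. SINR_MRC2 \<alpha> d snr g h X \<omega> \<ge> T} =
    (\<Sum>k<mD. (-1) ^ (k + mD) / (fact k * Gamma (real mD)) *
       (LBINT z:{0<..}. (1 / z) *
          (deriv ^^ k) (\<lambda>s. (deriv ^^ mD) (\<lambda>t. MRC_kernel lam \<alpha> d T mD mI snr z s t) 1) 1))"
proof -
  define \<sigma> where "\<sigma> = snr_inv snr"
  have \<sigma>: "\<sigma> \<ge> 0" using snr by (cases snr) (auto simp: \<sigma>_def snr_inv_def)
  have Gm: "Gamma (real mD) > 0" using mD by (intro Gamma_real_pos) simp
  \<comment> \<open>\<open>I\<close> lives on configurations of fading and locations, as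
    \<open>nn_integral_gains\<close> requires of its integrand; \<open>J\<close> is the same
    quantity as a random variable.\<close>
  define I where "I n p = d powr \<alpha> * enn2real (shot_noise n p) + \<sigma>" for n p
  define J where "J n \<omega> = I n (fading \<omega>, locations \<omega>)" for n \<omega>
  have [measurable]: "I n \<in> borel_measurable (Pi\<^sub>M fading_index (\<lambda>_. borel) \<Otimes>\<^sub>M Pi\<^sub>M UNIV (\<lambda>_. borel))" if "n \<in> {1,2}" for n
    unfolding I_def using that by measurable
  have J_meas [measurable]: "J n \<in> borel_measurable M" if "n \<in> {1,2}" for n
    unfolding J_def I_def using that by measurable
  have J0: "J n \<omega> \<ge> 0" for n \<omega> using \<sigma> by (simp add: J_def I_def)
  \<comment> \<open>The Gamma and Erlang computation divides by both quantities. For infinite SNR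
    \<sigma> is 0, and positivity rests on the shot noise alone.\<close>
  have J_pos: "AE \<omega> in M. J 1 \<omega> > 0 \<and> J 2 \<omega> > 0"
    using AE_shot_noise by eventually_elim (use \<sigma> d in \<open>auto simp: J_def I_def enn2real_positive_iff intro!: add_pos_nonneg\<close>)
  define F where "F q = (if T \<le> fst (fst q) / I 1 (snd q) + snd (fst q) / I 2 (snd q) then 1 else 0 :: ennreal)" for q
  have F_meas: "F \<in> borel_measurable ((borel \<Otimes>\<^sub>M borel) \<Otimes>\<^sub>M (Pi\<^sub>M fading_index (\<lambda>_. borel) \<Otimes>\<^sub>M Pi\<^sub>M UNIV (\<lambda>_. borel)))"
    unfolding F_def[abs_def] by measurable
  define A where "A z \<omega> = real mD * max 0 (T - z) * J 1 \<omega>" for z \<omega>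
  define B where "B z \<omega> = real mD * z * J 2 \<omega>" for z \<omega>
  define Q where "Q k z \<omega> = A z \<omega> ^ k * B z \<omega> ^ mD * exp (- A z \<omega> - B z \<omega>)" for k z \<omega>
  define c where "c k z = 1 / (z * Gamma (real mD) * fact k)" for k :: nat and z
  have [measurable]: "(\<lambda>p. Q k (fst p) (snd p)) \<in> borel_measurable (lborel \<Otimes>\<^sub>M M)"
    "(\<lambda>p. Q k (snd p) (fst p)) \<in> borel_measurable (M \<Otimes>\<^sub>M lborel)" for k
    unfolding Q_def A_def B_def by measurable
  have [measurable]: "Q k z \<in> borel_measurable M" for k z
    unfolding Q_def[abs_def] A_def B_def by measurable
  have [measurable]: "c k \<in> borel_measurable borel" for k
    unfolding c_def[abs_def] by measurable
  define D where "D k z = (deriv ^^ k) (\<lambda>s. (deriv ^^ mD) (\<lambda>t. MRC_kernel lam \<alpha> d T mD mI snr z s t) 1) 1" for k z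
  have Q_int: "integrable M (Q k z)" and D_eq: "D k z = (-1) ^ (k + mD) * expectation (Q k z)" if z: "z > 0" for k z
    using higher_deriv_MRC_kernel[OF d z, where snr = snr and T = T and k = k] \<sigma>
    unfolding D_def Q_def[abs_def] A_def B_def J_def I_def \<sigma>_def by auto
  have Q0: "Q k z \<omega> \<ge> 0" if "z > 0" for k z \<omega>
    using that J0 by (auto simp: Q_def A_def B_def intro!: mult_nonneg_nonneg)
  have c0: "c k z > 0" if "z > 0" for k z using that Gm by (simp add: c_def)
  \<comment> \<open>The k-th integrand free of signs: the sign of the mixed derivative cancels the
    one in the formula, so Tonelli can be applied throughout.\<close>
  define R where "R k z = indicator {0<..} z * (c k z * expectation (Q k z))" for k and z :: real
  have R0: "R k z \<ge> 0" for k z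
    unfolding R_def using Q0 c0 by (cases "z > 0") (auto intro!: mult_nonneg_nonneg integral_nonneg less_imp_le[OF c0])
  have EQ_meas: "(\<lambda>z. expectation (Q k z)) \<in> borel_measurable lborel" for k
    by (rule borel_measurable_lebesgue_integral) (simp add: split_beta')
  then have [measurable]: "R k \<in> borel_measurable borel" for k
    unfolding R_def[abs_def] by measurable
  have interf_meas [measurable]: "interference \<alpha> d h X n \<in> borel_measurable M" if "n \<in> {1,2}" for n
    unfolding interference_def[abs_def] using that by measurable
  have SINR: "SINR_MRC2 \<alpha> d snr g h X \<omega> =
      g 1 \<omega> / (interference \<alpha> d h X 1 \<omega> + \<sigma>) + g 2 \<omega> / (interference \<alpha> d h X 2 \<omega> + \<sigma>)" for \<omega>
    by (simp add: SINR_MRC2_def \<sigma>_def)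
  have [measurable]: "SINR_MRC2 \<alpha> d snr g h X \<in> borel_measurable M"
    unfolding SINR[abs_def] by measurable
  have "emeasure M {\<omega> \<in> space M. SINR_MRC2 \<alpha> d snr g h X \<omega> \<ge> T} =
      (\<integral>\<^sup>+\<omega>. indicator {\<omega> \<in> space M. SINR_MRC2 \<alpha> d snr g h X \<omega> \<ge> T} \<omega> \<partial>M)"
    by simp
  also have "\<dots> = (\<integral>\<^sup>+\<omega>. F ((g 1 \<omega>, g 2 \<omega>), (fading \<omega>, locations \<omega>)) \<partial>M)"
  proof (rule nn_integral_cong_AE)
    show "AE \<omega> in M. indicator {\<omega> \<in> space M. SINR_MRC2 \<alpha> d snr g h X \<omega> \<ge> T} \<omega> = F ((g 1 \<omega>, g 2 \<omega>), (fading \<omega>, locations \<omega>))"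
      using AE_interference_eq[of d] AE_space
      by eventually_elim (simp add: SINR F_def I_def indicator_def)
  qed
  also have "\<dots> = (\<integral>\<^sup>+\<omega>. (\<integral>\<^sup>+b. ennreal (gamma_density (real mD) b) *
       (\<integral>\<^sup>+a. ennreal (gamma_density (real mD) a) * F ((a, b), (fading \<omega>, locations \<omega>)) \<partial>lborel) \<partial>lborel) \<partial>M)"
    by (rule nn_integral_gains[OF F_meas])
  also have "\<dots> = (\<integral>\<^sup>+\<omega>. (\<integral>\<^sup>+z. indicator {0<..} z * (\<Sum>k<mD. ennreal (c k z * Q k z \<omega>)) \<partial>lborel) \<partial>M)"
  proof (rule nn_integral_cong_AE)
    show "AE \<omega> in M. (\<integral>\<^sup>+b. ennreal (gamma_density (real mD) b) *
         (\<integral>\<^sup>+a. ennreal (gamma_density (real mD) a) * F ((a, b), (fading \<omega>, locations \<omega>)) \<partial>lborel) \<partial>lborel) =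
       (\<integral>\<^sup>+z. indicator {0<..} z * (\<Sum>k<mD. ennreal (c k z * Q k z \<omega>)) \<partial>lborel)"
      using J_pos
    proof eventually_elim
      fix \<omega> assume "J 1 \<omega> > 0 \<and> J 2 \<omega> > 0"
      moreover have "F ((a, b), (fading \<omega>, locations \<omega>)) = indicator {a. T \<le> a / J 1 \<omega> + b / J 2 \<omega>} a" for a b
        by (simp add: F_def J_def indicator_def)
      ultimately show "(\<integral>\<^sup>+b. ennreal (gamma_density (real mD) b) *
         (\<integral>\<^sup>+a. ennreal (gamma_density (real mD) a) * F ((a, b), (fading \<omega>, locations \<omega>)) \<partial>lborel) \<partial>lborel) =
       (\<integral>\<^sup>+z. indicator {0<..} z * (\<Sum>k<mD. ennreal (c k z * Q k z \<omega>)) \<partial>lborel)"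
        using nn_integral_gamma_density_MRC[OF mD, of "J 1 \<omega>" "J 2 \<omega>" T]
        by (simp only: c_def Q_def A_def B_def)
    qed
  qed
  also have "\<dots> = (\<integral>\<^sup>+z. (\<integral>\<^sup>+\<omega>. indicator {0<..} z * (\<Sum>k<mD. ennreal (c k z * Q k z \<omega>)) \<partial>M) \<partial>lborel)"
  proof -
    interpret pair_sigma_finite lborel M ..
    show ?thesis by (rule Fubini') (simp add: split_beta')
  qed
  also have "\<dots> = (\<integral>\<^sup>+z. (\<Sum>k<mD. ennreal (R k z)) \<partial>lborel)"
  proof (rule nn_integral_cong)
    fix z :: real
    show "(\<integral>\<^sup>+\<omega>. indicator {0<..} z * (\<Sum>k<mD. ennreal (c k z * Q k z \<omega>)) \<partial>M) = (\<Sum>k<mD. ennreal (R k z))"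
    proof (cases "z > 0")
      case z: True
      have "(\<integral>\<^sup>+\<omega>. ennreal (c k z * Q k z \<omega>) \<partial>M) = ennreal (c k z * expectation (Q k z))" for k
        using Q0[OF z] c0[OF z] Q_int[OF z]
        by (subst nn_integral_eq_integral) (auto intro!: mult_nonneg_nonneg less_imp_le[OF c0[OF z]])
      then show ?thesis using z by (simp add: nn_integral_sum R_def)
    qed (simp add: R_def)
  qed
  also have "\<dots> = (\<Sum>k<mD. \<integral>\<^sup>+z. ennreal (R k z) \<partial>lborel)"
    by (rule nn_integral_sum) simp
  finally have eq: "ennreal (prob {\<omega> \<in> space M. SINR_MRC2 \<alpha> d snr g h X \<omega> \<ge> T}) = (\<Sum>k<mD. \<integral>\<^sup>+z. ennreal (R k z) \<partial>lborel)"
    by (simp add: emeasure_eq_measure)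
  \<comment> \<open>The nonnegative terms add up to a probability, so none of them is infinite. No
    estimate of the kernel near 0 or at infinity is required.\<close>
  have fin: "(\<integral>\<^sup>+z. ennreal (R k z) \<partial>lborel) \<noteq> \<top>" if "k < mD" for k
  proof
    assume "(\<integral>\<^sup>+z. ennreal (R k z) \<partial>lborel) = \<top>"
    then have "(\<Sum>k<mD. \<integral>\<^sup>+z. ennreal (R k z) \<partial>lborel) = \<top>" using that by (subst ennreal_sum_eq_top) auto
    with eq show False by simp
  qed
  have "(\<integral>\<^sup>+z. ennreal (R k z) \<partial>lborel) = ennreal (\<integral>z. R k z \<partial>lborel)" if "k < mD" for k
    using fin[OF that] R0 by (intro nn_integral_eq_integral integrableI_nonneg) (auto simp: less_top[symmetric])
  then have "ennreal (prob {\<omega> \<in> space M. SINR_MRC2 \<alpha> d snr g h X \<omega> \<ge> T}) = ennreal (\<Sum>k<mD. \<integral>z. R k z \<partial>lborel)"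
    unfolding eq using R0 by (subst sum_ennreal[symmetric]) (auto intro!: integral_nonneg)
  then have "prob {\<omega> \<in> space M. SINR_MRC2 \<alpha> d snr g h X \<omega> \<ge> T} = (\<Sum>k<mD. \<integral>z. R k z \<partial>lborel)"
    using R0 by (subst (asm) ennreal_inj) (auto intro!: sum_nonneg integral_nonneg)
  also have "\<dots> = (\<Sum>k<mD. (-1) ^ (k + mD) / (fact k * Gamma (real mD)) * (LBINT z:{0<..}. (1 / z) * D k z))"
  proof (rule sum.cong[OF refl])
    fix k
    have sq: "(-1::real) ^ (k + mD) * (-1) ^ (k + mD) = 1" by (simp flip: power_mult_distrib)
    have "R k z = (-1) ^ (k + mD) / (fact k * Gamma (real mD)) * (indicator {0<..} z *\<^sub>R ((1 / z) * D k z))" for z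
    proof (cases "z > 0")
      case True
      have "(-1) ^ (k + mD) / (fact k * Gamma (real mD)) * ((1 / z) * D k z) =
          ((-1) ^ (k + mD) * (-1) ^ (k + mD)) * (c k z * expectation (Q k z))"
        unfolding D_eq[OF True] c_def by simp
      then show ?thesis using True unfolding sq by (simp add: R_def)
    qed (simp add: R_def)
    then show "(\<integral>z. R k z \<partial>lborel) = (-1) ^ (k + mD) / (fact k * Gamma (real mD)) * (LBINT z:{0<..}. (1 / z) * D k z)"
      unfolding set_lebesgue_integral_def by (simp only: integral_mult_right_zero)
  qed
  finally show ?thesis unfolding D_def .
qed

end

theorem theorem1:
  fixes M :: "'a measure"
    and X :: "nat \<Rightarrow> 'a \<Rightarrow> real^2"
    and g :: "nat \<Rightarrow> 'a \<Rightarrow> real"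
    and h :: "nat \<Rightarrow> nat \<Rightarrow> 'a \<Rightarrow> real"
    and lam d \<alpha> T mI :: real
    and mD :: nat
    and snr :: ereal
  assumes "prob_space M"
    and "lam > 0" and "d > 0" and "\<alpha> > 2" and "T > 0" and "mD \<ge> 1" and "mI > 0" and "snr > 0"
    and PPP: "is_PPP M lam X"
    and g_distr: "\<And>n. n \<in> {1,2} \<Longrightarrow> distributed M lborel (g n) (\<lambda>y. ennreal (gamma_density (real mD) y))"
    and h_distr: "\<And>n i. n \<in> {1,2} \<Longrightarrow> distributed M lborel (h n i) (\<lambda>y. ennreal (gamma_density mI y))"
    and marks_indep: "prob_space.indep_vars M (\<lambda>_. borel)
        (\<lambda>j. case j of Inl n \<Rightarrow> g n | Inr (n, i) \<Rightarrow> h n i)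
        (Inl ` {1,2} \<union> Inr ` ({1,2} \<times> UNIV))"
    and marks_indep_PPP: "prob_space.indep_set M
        (sigma_sets (space M)
          {(\<lambda>\<omega>. \<lambda>j\<in>Inl ` {1,2} \<union> Inr ` ({1,2} \<times> UNIV).
              (case j of Inl n \<Rightarrow> g n \<omega> | Inr (n, i) \<Rightarrow> h n i \<omega>)) -` A \<inter> space M
           | A. A \<in> sets (Pi\<^sub>M (Inl ` {1,2} \<union> Inr ` ({1,2} \<times> UNIV)) (\<lambda>_. (borel :: real measure)))})
        (sigma_sets (space M)
          {(\<lambda>\<omega> i. X i \<omega>) -` B \<inter> space M
           | B. B \<in> sets (Pi\<^sub>M (UNIV :: nat set) (\<lambda>_. (borel :: (real^2) measure)))})"
  shows "measure M {\<omega> \<in> space M. SINR_MRC2 \<alpha> d snr g h X \<omega> \<ge> T} =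
    (\<Sum>k<mD. (-1) ^ (k + mD) / (fact k * Gamma (real mD)) *
       (LBINT z:{0<..}. (1 / z) *
          (deriv ^^ k) (\<lambda>s. (deriv ^^ mD) (\<lambda>t. MRC_kernel lam \<alpha> d T mD mI snr z s t) 1) 1))"
proof -
  interpret mrc_model M X g h lam \<alpha> mI mD
    using assms by (intro mrc_model.intro mrc_model_axioms.intro)
  show ?thesis by (rule success_probability) fact+
qed

end
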